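(* Let $G$ be a connected $(C_4,\text{diamond})$-free graph on $n$ vertices and let $1\le k\le n-1$. Then $F_k(G)$ is uniquely reconstructible as the $k$-token graph of $G$.
   Context: For a graph $G$ on $n$ vertices and $1\le k\le n-1$, $F_k(G)$ is the graph on the $k$-subsets of $V(G)$ in which $A,B$ are adjacent iff $A\triangle B$ is an edge of $G$. A diamond is $K_4$ minus an edge; $(C_4,\text{diamond})$-free means no induced $4$-cycle and no induced diamond. For graphs $H,G$ let $\operatorname{Iso}(H,G)$ be the set of isomorphisms $H\to G$ and $\operatorname{Aut}(G)$ the automorphism group. For $\psi\in\operatorname{Iso}(H,G)$ let $\iota(\psi):V(F_k(H))\to V(F_k(G))$, $\iota(\psi)(A)=\{\psi(v):v\in A\}$. Let $\mathfrak{c}$ be the map sending each $k$-subset $A$ of $V(G)$ to $V(G)\setminus A$ (an isomorphism $F_k(G)\to F_{n-k}(G)$). A $k$-token reconstruction of a graph $F$ is a pair $(G',\varphi)$ with $\varphi$ an isomorphism $F\to F_k(G')$. Two $k$-token reconstructions $(G,\varphi)$ and $(G,\psi)$ of $F$ are equivalent if there exists $s\in\operatorname{Aut}(G)$ with $\psi=\iota(s)\circ\varphi$ or $\psi=\mathfrak{c}\circ\iota(s)\circ\varphi$. A graph $F$ is uniquely reconstructible as the $k$-token graph of $G$ if any two $k$-token reconstructions of $F$ of the form $(G,\cdot)$ are equivalent. *)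

theory Defs
  imports Main
begin

definition simple_graph :: "'a set \<Rightarrow> 'a set set \<Rightarrow> bool" where
  "simple_graph V E \<longleftrightarrow> finite V \<and> (\<forall>e\<in>E. e \<subseteq> V \<and> card e = 2)"

definition adj :: "'a set set \<Rightarrow> 'a \<Rightarrow> 'a \<Rightarrow> bool" where
  "adj E u v \<longleftrightarrow> {u, v} \<in> E"

definition connected_graph :: "'a set \<Rightarrow> 'a set set \<Rightarrow> bool" where
  "connected_graph V E \<longleftrightarrow> V \<noteq> {} \<and> (\<forall>u\<in>V. \<forall>v\<in>V. (adj E)\<^sup>*\<^sup>* u v)"

definition C4_free :: "'a set \<Rightarrow> 'a set set \<Rightarrow> bool" where
  "C4_free V E \<longleftrightarrow> \<not> (\<exists>a\<in>V. \<exists>b\<in>V. \<exists>c\<in>V. \<exists>d\<in>V. distinct [a, b, c, d] \<and>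
      adj E a b \<and> adj E b c \<and> adj E c d \<and> adj E d a \<and> \<not> adj E a c \<and> \<not> adj E b d)"

definition diamond_free :: "'a set \<Rightarrow> 'a set set \<Rightarrow> bool" where
  "diamond_free V E \<longleftrightarrow> \<not> (\<exists>a\<in>V. \<exists>b\<in>V. \<exists>c\<in>V. \<exists>d\<in>V. distinct [a, b, c, d] \<and>
      adj E a b \<and> adj E a c \<and> adj E a d \<and> adj E b c \<and> adj E b d \<and> \<not> adj E c d)"

definition token_vertices :: "'a set \<Rightarrow> nat \<Rightarrow> 'a set set" where
  "token_vertices V k = {A. A \<subseteq> V \<and> card A = k}"

definition token_edges :: "'a set \<Rightarrow> 'a set set \<Rightarrow> nat \<Rightarrow> 'a set set set" where
  "token_edges V E k = {{A, B} | A B. A \<in> token_vertices V k \<and> B \<in> token_vertices V k \<and>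
      (A - B) \<union> (B - A) \<in> E}"

definition graph_iso :: "'a set \<Rightarrow> 'a set set \<Rightarrow> 'b set \<Rightarrow> 'b set set \<Rightarrow> ('a \<Rightarrow> 'b) \<Rightarrow> bool" where
  "graph_iso V1 E1 V2 E2 f \<longleftrightarrow> bij_betw f V1 V2 \<and>
      (\<forall>u\<in>V1. \<forall>v\<in>V1. {u, v} \<in> E1 \<longleftrightarrow> {f u, f v} \<in> E2)"

definition graph_aut :: "'a set \<Rightarrow> 'a set set \<Rightarrow> ('a \<Rightarrow> 'a) \<Rightarrow> bool" where
  "graph_aut V E s \<longleftrightarrow> graph_iso V E V E s"

definition token_reconstruction ::
  "'b set \<Rightarrow> 'b set set \<Rightarrow> 'a set \<Rightarrow> 'a set set \<Rightarrow> nat \<Rightarrow> ('b \<Rightarrow> 'a set) \<Rightarrow> bool" where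
  "token_reconstruction VF EF V E k \<phi> \<longleftrightarrow>
     graph_iso VF EF (token_vertices V k) (token_edges V E k) \<phi>"

definition equivalent_reconstructions ::
  "'b set \<Rightarrow> 'a set \<Rightarrow> 'a set set \<Rightarrow> ('b \<Rightarrow> 'a set) \<Rightarrow> ('b \<Rightarrow> 'a set) \<Rightarrow> bool" where
  "equivalent_reconstructions VF V E \<phi> \<psi> \<longleftrightarrow>
     (\<exists>s. graph_aut V E s \<and>
        ((\<forall>x\<in>VF. \<psi> x = s ` \<phi> x) \<or> (\<forall>x\<in>VF. \<psi> x = V - s ` \<phi> x)))"

definition uniquely_reconstructible ::
  "'b set \<Rightarrow> 'b set set \<Rightarrow> 'a set \<Rightarrow> 'a set set \<Rightarrow> nat \<Rightarrow> bool" where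
  "uniquely_reconstructible VF EF V E k \<longleftrightarrow>
     (\<forall>\<phi> \<psi>. token_reconstruction VF EF V E k \<phi> \<and> token_reconstruction VF EF V E k \<psi> \<longrightarrow>
        equivalent_reconstructions VF V E \<phi> \<psi>)"

end

(*
  Composing one reconstruction with the inverse of the other gives an automorphism f of F_k(G).
  An edge of F_k(G) at A is labelled by the edge e of G along which a token moves, and lab f A e is
  the label of its image under f. Moves along disjoint edges span the induced 4-cycles of F_k(G):
  since G is (C4, diamond)-free, two moves along touching edges lead to vertices that are adjacent
  or have a single common neighbour. So f preserves disjointness of labels, and lab f A e does not
  change when A is modified by a move disjoint from e.

  The heart of the proof is that lab f A e does not depend on A at all. For e = {a, b} one has to
  transport a token of A between neighbours c, d of the edge e. If c - a - b - d is a path this is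
  read off a square with two pendant edges. If a is the centre of an induced claw with leaves b, c,
  d, two tokens run through a hexagon of F_k(G); its image either is again such a hexagon, with
  opposite labels equal, or is a single token (or hole) walking around a 6-cycle of G. The latter is
  impossible: bring another token (or hole) next to the 6-cycle; its move onto the cycle is disjoint
  from four consecutive labels but touches the other two, while in the source any three consecutive
  labels already cover the claw.

  Hence f induces a permutation of E that preserves touching and triangles, which comes from an
  automorphism s of G as in Whitney's theorem on line graphs. Finally the symmetric difference of
  f A and s ` A is the same set for all A and a union of components of G, so it is empty or V.
*)
theory Submission
  imports Defs
begin

section \<open>Symmetric differences, two-element sets and the transport of tokens\<close>

definition sd :: "'a set \<Rightarrow> 'a set \<Rightarrow> 'a set" (infixl "\<triangle>" 65)
  where "A \<triangle> B = (A - B) \<union> (B - A)"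

lemma in_sd [simp]: "x \<in> A \<triangle> B \<longleftrightarrow> (x \<in> A) \<noteq> (x \<in> B)"
  by (auto simp: sd_def)

lemma sd_commute: "A \<triangle> B = B \<triangle> A"
  and sd_assoc: "A \<triangle> B \<triangle> C = A \<triangle> (B \<triangle> C)"
  and sd_left_commute: "A \<triangle> (B \<triangle> C) = B \<triangle> (A \<triangle> C)"
  and sd_self [simp]: "A \<triangle> A = {}"
  and sd_self_left [simp]: "A \<triangle> (A \<triangle> B) = B"
  and sd_self_right [simp]: "A \<triangle> B \<triangle> B = A"
  and sd_empty [simp]: "A \<triangle> {} = A" "{} \<triangle> A = A"
  by (auto simp: set_eq_iff)

lemmas sd_ac = sd_assoc sd_commute sd_left_commute

lemma sd_cancel [simp]: "A \<triangle> B = A \<triangle> C \<longleftrightarrow> B = C" "B \<triangle> A = C \<triangle> A \<longleftrightarrow> B = C"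
  by (auto simp: set_eq_iff)

lemma sd_eq_empty [simp]: "A \<triangle> B = {} \<longleftrightarrow> A = B"
  by (auto simp: set_eq_iff)

lemma sd_eq_left [simp]: "A \<triangle> B = A \<longleftrightarrow> B = {}"
  using sd_cancel(1)[of A B "{}"] by (simp only: sd_empty)

lemma sd_pairs: "b \<noteq> d \<Longrightarrow> b \<noteq> m \<Longrightarrow> d \<noteq> m \<Longrightarrow> {m, b} \<triangle> {m, d} = {b, d}"
  by (auto simp: set_eq_iff)

lemma pair_of_mem:
  assumes "card e = 2" "m \<in> e"
  obtains b where "e = {m, b}" "b \<noteq> m"
  using assms by (auto simp: card_2_iff doubleton_eq_iff)

lemma touching_pairs:
  assumes "card x = 2" "card y = 2" "x \<noteq> y" "x \<inter> y \<noteq> {}"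
  obtains m b d where "x = {m, b}" "y = {m, d}" "b \<noteq> d" "b \<noteq> m" "d \<noteq> m"
proof -
  obtain m where m: "m \<in> x" "m \<in> y" using assms(4) by auto
  obtain b where "x = {m, b}" "b \<noteq> m" using pair_of_mem[OF assms(1) m(1)] .
  moreover obtain d where "y = {m, d}" "d \<noteq> m" using pair_of_mem[OF assms(2) m(2)] .
  ultimately show ?thesis using assms(3) that by auto
qed

lemma disjoint_pairs:
  assumes "card x = 2" "card y = 2" "x \<inter> y = {}"
  obtains p q r s where "x = {p, q}" "y = {r, s}" "distinct [p, q, r, s]"
  using assms by (auto simp: card_2_iff)

text \<open>Disjoint pairs would differ in four elements, so the two share an element
  \<open>m\<close>.\<close>

lemma pairs_with_pair_difference:
  assumes "card g = 2" "card h = 2" "g \<triangle> h = {b, d}" "b \<noteq> d"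
  obtains m where "m \<noteq> b" "m \<noteq> d" "g = {b, m} \<and> h = {d, m} \<or> g = {d, m} \<and> h = {b, m}"
proof -
  have "g \<inter> h \<noteq> {}"
  proof
    assume disj: "g \<inter> h = {}"
    then have "g \<triangle> h = g \<union> h" by auto
    moreover have "card (g \<union> h) = 4" using assms(1,2) disj by (simp add: card_Un_disjoint card_ge_0_finite)
    ultimately show False using assms(3,4) by (auto dest!: arg_cong[where f = card])
  qed
  moreover have "g \<noteq> h" using assms(3) by auto
  ultimately obtain m b' d' where m: "g = {m, b'}" "h = {m, d'}" "b' \<noteq> d'" "b' \<noteq> m" "d' \<noteq> m"
    using touching_pairs[OF assms(1,2)] by blast
  then have "{b', d'} = {b, d}" using sd_pairs[of b' d' m] assms(3) by simp
  then show ?thesis using that[of m] m by (auto simp: doubleton_eq_iff)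
qed

text \<open>Single steps along \<open>R\<close> carry any \<open>j\<close>-subset of
  \<open>W\<close> to any other. The tokens are indistinguishable, so a token that blocks the way
  can go ahead while the other takes its place.\<close>

lemma token_transport:
  fixes h :: "'a set \<Rightarrow> 'b"
  assumes fin: "finite W"
    and conn: "\<And>c d. c \<in> W \<Longrightarrow> d \<in> W \<Longrightarrow> (\<lambda>c d. c \<in> W \<and> d \<in> W \<and> R c d)\<^sup>*\<^sup>* c d"
    and step: "\<And>C c d. C \<subseteq> W \<Longrightarrow> Suc (card C) = j \<Longrightarrow> c \<in> W - C \<Longrightarrow> d \<in> W - C \<Longrightarrow> c \<noteq> d \<Longrightarrow> R c d
      \<Longrightarrow> h (insert c C) = h (insert d C)"
    and AB: "A \<subseteq> W" "B \<subseteq> W" "card A = j" "card B = j"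
  shows "h A = h B"
proof -
  let ?R = "\<lambda>c d. c \<in> W \<and> d \<in> W \<and> R c d"
  have move: "h (insert c C) = h (insert d C)"
    if "?R\<^sup>*\<^sup>* c d" "C \<subseteq> W" "Suc (card C) = j" "c \<in> W - C" "d \<in> W - C" for C c d
    using that
  proof (induction arbitrary: C rule: rtranclp_induct)
    case base
    then show ?case by simp
  next
    case (step m d)
    consider "c = m" | "c = d" | "m = d" | "c \<noteq> m" "c \<noteq> d" "m \<noteq> d" by blast
    then show ?case
    proof cases
      case 1
      then show ?thesis using step assms(3)[of C c d] by (cases "c = d") auto
    next
      case 2
      then show ?thesis by simp
    next
      case 3
      then show ?thesis using step by simp
    next
      case 4
      show ?thesis
      proof (cases "m \<in> C")
        case False
        then have "h (insert c C) = h (insert m C)" using step by auto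
        also have "\<dots> = h (insert d C)" using step False 4 assms(3)[of C m d] by auto
        finally show ?thesis .
      next
        case True
        have finC: "finite C" using step.prems(1) fin finite_subset by blast
        \<comment> \<open>The token on \<open>m\<close> steps on to \<open>d\<close> first; the
          induction hypothesis, with \<open>d\<close> now occupied, then brings \<open>c\<close> to
          \<open>m\<close>.\<close>
        define D where "D = C - {m}"
        have C: "C = insert m D" "m \<notin> D" and finD: "finite D" using True finC by (auto simp: D_def)
        then have cD: "card C = Suc (card D)" by simp
        have "h (insert c C) = h (insert m (insert c D))" using C by (simp add: insert_commute)
        also have "\<dots> = h (insert d (insert c D))"
          using step 4 C cD finD by (intro assms(3)) auto
        also have "\<dots> = h (insert c (insert d D))" by (simp add: insert_commute)
        also have "\<dots> = h (insert m (insert d D))"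
          using step 4 C cD finD by (intro step.IH) auto
        also have "\<dots> = h (insert d C)" using C by (simp add: insert_commute)
        finally show ?thesis .
      qed
    qed
  qed
  have "h A = h B" if "card (A - B) = n" "A \<subseteq> W" "card A = j" for n A
    using that
  proof (induction n arbitrary: A)
    case 0
    have finA: "finite A" "finite B" using 0 AB fin finite_subset by blast+
    have "A \<subseteq> B" using 0 finA by auto
    then have "A = B" using finA AB 0 by (metis card_subset_eq)
    then show ?case by simp
  next
    case (Suc n)
    have finA: "finite A" "finite B" using Suc AB fin finite_subset by blast+
    obtain c where c: "c \<in> A" "c \<notin> B" using Suc.prems(1) by (metis card.empty Diff_eq_empty_iff nat.distinct(1) subsetI)
    have "\<not> B \<subseteq> A" using finA AB Suc c by (metis card_subset_eq)
    then obtain d where d: "d \<in> B" "d \<notin> A" by blast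
    define C where "C = A - {c}"
    have C: "A = insert c C" "c \<notin> C" "finite C" using c finA by (auto simp: C_def)
    then have cC: "Suc (card C) = j" using Suc by simp
    have "h A = h (insert d C)" using move[of c d C] conn[of c d] C cC c d Suc.prems AB by auto
    also have "\<dots> = h B"
    proof (rule Suc.IH)
      have "insert d C - B = (A - B) - {c}" using C c d by auto
      then show "card (insert d C - B) = n" using Suc.prems c finA by simp
    qed (use C d cC Suc.prems AB in auto)
    finally show ?case .
  qed
  then show ?thesis using AB by blast
qed

section \<open>The graph and the moves in its token graph\<close>

locale token_graph =
  fixes V :: "'a set" and E :: "'a set set" and k :: nat
  assumes simple: "simple_graph V E"
    and connected: "connected_graph V E"
    and C4_free: "C4_free V E"
    and diamond_free: "diamond_free V E"
    and k_pos: "1 \<le> k" and k_less: "k \<le> card V - 1"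
begin

abbreviation "TV \<equiv> token_vertices V k"

text \<open>That \<open>A \<triangle> e\<close> again has \<open>k\<close> elements amounts to
  exactly one end of \<open>e\<close> being occupied (\<open>moves_pair\<close>). A move is thus
  recorded by its start and its label.\<close>

definition moves :: "'a set \<Rightarrow> 'a set \<Rightarrow> bool" where
  "moves A e \<longleftrightarrow> e \<in> E \<and> A \<in> TV \<and> A \<triangle> e \<in> TV"

lemma finite_V: "finite V" using simple by (simp add: simple_graph_def)

lemma card_edge: "e \<in> E \<Longrightarrow> card e = 2" using simple by (simp add: simple_graph_def)

lemma edge_subset: "e \<in> E \<Longrightarrow> e \<subseteq> V" using simple by (simp add: simple_graph_def)

lemma edge_ends: "{p, q} \<in> E \<Longrightarrow> p \<noteq> q \<and> p \<in> V \<and> q \<in> V"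
  using card_edge[of "{p, q}"] edge_subset[of "{p, q}"] by (auto simp: card_2_iff doubleton_eq_iff)

lemma empty_not_edge [simp]: "{} \<notin> E" using card_edge[of "{}"] by auto

text \<open>C4-freeness provides one chord, and diamond-freeness then the other. Both forbidden
  subgraphs enter the proof only here.\<close>

lemma four_cycle_chords:
  assumes "{p, q} \<in> E" "{q, r} \<in> E" "{r, s} \<in> E" "{s, p} \<in> E" "p \<noteq> r" "q \<noteq> s"
  shows "{p, r} \<in> E" "{q, s} \<in> E"
proof -
  have V: "p \<in> V" "q \<in> V" "r \<in> V" "s \<in> V" and d: "distinct [p, q, r, s]"
    using edge_ends[OF assms(1)] edge_ends[OF assms(2)] edge_ends[OF assms(3)] edge_ends[OF assms(4)] assms(5,6)
    by auto
  have sym: "adj E x y \<longleftrightarrow> adj E y x" for x y by (simp add: adj_def insert_commute)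
  have cycle: "adj E p q" "adj E q r" "adj E r s" "adj E s p" using assms by (simp_all add: adj_def)
  have 1: "adj E p r \<or> adj E q s"
    using C4_free V d cycle unfolding C4_free_def by blast
  have 2: "adj E y z" if "x \<in> V" "y \<in> V" "z \<in> V" "w \<in> V" "distinct [x, w, y, z]"
    "adj E x y" "adj E x z" "adj E w y" "adj E w z" "adj E x w" for x y z w
    using diamond_free that unfolding diamond_free_def by blast
  show "{p, r} \<in> E" "{q, s} \<in> E"
    using 1 2[of p q s r] 2[of q p r s] V d cycle sym unfolding adj_def[symmetric] by auto
qed

text \<open>Two common neighbours would close a 4-cycle in which the chord \<open>{b, d}\<close> is
  missing.\<close>

lemma unique_common_neighbour:
  assumes "{b, d} \<notin> E" "b \<noteq> d" "{m, b} \<in> E" "{m, d} \<in> E" "{m', b} \<in> E" "{m', d} \<in> E"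
  shows "m = m'"
  using four_cycle_chords(1)[of b m d m'] assms by (auto simp: insert_commute)

lemma TV_iff: "A \<in> TV \<longleftrightarrow> A \<subseteq> V \<and> card A = k"
  by (simp add: token_vertices_def)

lemma finite_TV: "A \<in> TV \<Longrightarrow> finite A"
  using finite_V finite_subset TV_iff by blast

lemma TV_sd_pair:
  assumes "A \<in> TV" "p \<in> V" "q \<in> V" "p \<noteq> q"
  shows "A \<triangle> {p, q} \<in> TV \<longleftrightarrow> (p \<in> A) \<noteq> (q \<in> A)"
proof -
  have fin: "finite A" using assms finite_TV by blast
  have sub: "A \<triangle> {p, q} \<subseteq> V" using assms by (auto simp: TV_iff)
  consider "p \<in> A" "q \<in> A" | "p \<in> A" "q \<notin> A" | "p \<notin> A" "q \<in> A" | "p \<notin> A" "q \<notin> A" by blast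
  then have "card (A \<triangle> {p, q}) = card A \<longleftrightarrow> (p \<in> A) \<noteq> (q \<in> A)"
  proof cases
    case 1
    then have "A \<triangle> {p, q} = A - {p, q}" by auto
    moreover have "card A > 0" using 1 fin card_gt_0_iff by blast
    ultimately show ?thesis using 1 fin assms by (simp add: card_Diff_subset)
  next
    case 2
    then have "A \<triangle> {p, q} = insert q (A - {p})" by auto
    moreover have "card A > 0" using 2 fin card_gt_0_iff by blast
    ultimately show ?thesis using 2 fin assms by simp
  next
    case 3
    then have "A \<triangle> {p, q} = insert p (A - {q})" by auto
    moreover have "card A > 0" using 3 fin card_gt_0_iff by blast
    ultimately show ?thesis using 3 fin assms by simp
  next
    case 4
    then have "A \<triangle> {p, q} = insert p (insert q A)" by auto
    then show ?thesis using 4 fin assms by simp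
  qed
  then show ?thesis using assms sub by (simp add: TV_iff)
qed

lemma TV_insert2:
  assumes "C \<subseteq> V" "Suc (card C) = k - 1" "s \<in> V - C" "t \<in> V - C" "s \<noteq> t"
  shows "insert s (insert t C) \<in> TV"
  using assms finite_subset[OF assms(1) finite_V] by (auto simp: TV_iff)

lemma moves_pair: "moves A {p, q} \<longleftrightarrow> {p, q} \<in> E \<and> A \<in> TV \<and> (p \<in> A) \<noteq> (q \<in> A)"
  unfolding moves_def using TV_sd_pair edge_ends by blast

lemma moves_back: "moves A e \<Longrightarrow> moves (A \<triangle> e) e"
  by (simp add: moves_def sd_assoc)

lemma moves_cong:
  assumes "moves A e" "B \<in> TV" "A \<inter> e = B \<inter> e"
  shows "moves B e"
proof -
  obtain p q where "e = {p, q}" using assms(1) card_edge[of e] by (auto simp: moves_def card_2_iff)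
  then show ?thesis using assms by (auto simp: moves_pair)
qed

lemma moves_disjoint:
  assumes "moves A e" "moves A e'" "e \<inter> e' = {}"
  shows "moves (A \<triangle> e') e"
  using assms by (intro moves_cong[OF assms(1)]) (auto simp: moves_def)

text \<open>The edges \<open>g\<close>, \<open>h\<close> leading from the two neighbours to
  \<open>Z\<close> differ by \<open>{b, d}\<close>, so they share a common neighbour of
  \<open>b\<close> and \<open>d\<close>, which can only be \<open>m\<close>. If
  \<open>g = {m, b}\<close>, then \<open>Z = A\<close>. The crossed choice gives
  \<open>A \<triangle> {b, d}\<close>, which has the wrong size since \<open>b\<close> and
  \<open>d\<close> are both occupied or both empty.\<close>

lemma touching_moves_common_neighbour:
  assumes "moves A {m, b}" "moves A {m, d}" "b \<noteq> d" "{b, d} \<notin> E"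
    and "Z \<in> TV" "Z \<triangle> (A \<triangle> {m, b}) \<in> E" "Z \<triangle> (A \<triangle> {m, d}) \<in> E"
  shows "Z = A"
proof -
  have me: "m \<noteq> b" "m \<noteq> d" "{m, b} \<in> E" "{m, d} \<in> E" "A \<in> TV" "b \<in> V" "d \<in> V"
    using assms edge_ends by (auto simp: moves_def)
  define g where "g = Z \<triangle> (A \<triangle> {m, b})"
  define h where "h = Z \<triangle> (A \<triangle> {m, d})"
  have "g \<triangle> h = {m, b} \<triangle> {m, d}" unfolding g_def h_def by (simp add: sd_ac)
  also have "\<dots> = {b, d}" using me assms(3) by (intro sd_pairs) auto
  finally have gh: "g \<triangle> h = {b, d}" .
  have Z: "Z = A \<triangle> {m, b} \<triangle> g" unfolding g_def by (simp add: sd_ac)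
  have E: "g \<in> E" "h \<in> E" using assms(6,7) by (simp_all add: g_def h_def)
  obtain m' where m': "g = {b, m'} \<and> h = {d, m'} \<or> g = {d, m'} \<and> h = {b, m'}"
    by (rule pairs_with_pair_difference[OF card_edge[OF E(1)] card_edge[OF E(2)] gh assms(3)])
  have "{m', b} \<in> E \<and> {m', d} \<in> E" using m' E by (auto simp: insert_commute)
  then have "m = m'"
    using unique_common_neighbour[OF assms(4,3) me(3,4)] by blast
  show ?thesis
  proof (cases "g = {b, m'}")
    case True
    then have "g = {m, b}" using \<open>m = m'\<close> by auto
    then show ?thesis using Z by simp
  next
    case False
    then have "g = {m, d}" using m' \<open>m = m'\<close> by auto
    then have "Z = A \<triangle> ({m, b} \<triangle> {m, d})" using Z by (simp only: sd_assoc)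
    then have "Z = A \<triangle> {b, d}" using sd_pairs[of b d m] me assms(3) by simp
    moreover have "(b \<in> A) = (d \<in> A)" using assms(1,2) by (auto simp: moves_pair)
    ultimately show ?thesis using TV_sd_pair[of A b d] me assms(3,5) by auto
  qed
qed

text \<open>The edges \<open>g\<close>, \<open>h\<close> leading from the two neighbours to
  \<open>Z\<close> differ by \<open>x \<union> y\<close>, which forces \<open>g\<close> into these
  four vertices. If \<open>g\<close> joins \<open>x\<close> to \<open>y\<close>, so does
  \<open>h\<close>, and the resulting 4-cycle has both chords, one of which is
  \<open>Z \<triangle> A\<close>. As \<open>g = x\<close> means \<open>Z = A\<close>, only
  \<open>g = y\<close> remains.\<close>

lemma disjoint_moves_common_neighbour:
  assumes "x \<in> E" "y \<in> E" "x \<inter> y = {}"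
    and "Z \<triangle> (A \<triangle> x) \<in> E" "Z \<triangle> (A \<triangle> y) \<in> E" "Z \<noteq> A" "Z \<triangle> A \<notin> E"
  shows "Z = A \<triangle> x \<triangle> y"
proof -
  define g where "g = Z \<triangle> (A \<triangle> x)"
  define h where "h = Z \<triangle> (A \<triangle> y)"
  obtain p q r s where xy: "x = {p, q}" "y = {r, s}" and d: "distinct [p, q, r, s]"
    by (rule disjoint_pairs[OF card_edge[OF assms(1)] card_edge[OF assms(2)] assms(3)])
  have pqrs: "{p, q, r, s} = {p, q} \<triangle> {r, s}" using d by auto
  have gh: "h = g \<triangle> {p, q, r, s}"
    unfolding g_def h_def xy pqrs by (simp add: sd_ac)
  have Z: "Z = A \<triangle> {p, q} \<triangle> g" "Z = A \<triangle> {r, s} \<triangle> h"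
    unfolding g_def h_def xy by (simp_all add: sd_ac)
  have ZA: "Z \<triangle> A = {p, q} \<triangle> g" unfolding g_def xy by (simp add: sd_ac)
  have "g \<in> E" "h \<in> E" using assms by (simp_all add: g_def h_def)
  then have c: "card g = 2" "card h = 2" "g \<in> E" "h \<in> E" using card_edge by auto
  have sub: "g \<subseteq> {p, q, r, s}"
  proof (rule ccontr)
    assume "\<not> ?thesis"
    then obtain z where z: "z \<in> g" "z \<notin> {p, q, r, s}" by blast
    obtain t where g: "g = {z, t}" "t \<noteq> z" using pair_of_mem[OF c(1) z(1)] .
    obtain u v where h: "h = {u, v}" using c by (auto simp: card_2_iff)
    \<comment> \<open>Here \<open>g\<close> contains at most one of the four vertices, so
      \<open>h\<close> contains at least three.\<close>
    have "p \<in> h \<and> q \<in> h \<and> r \<in> h \<or> p \<in> h \<and> q \<in> h \<and> s \<in> h \<or> p \<in> h \<and> r \<in> h \<and> s \<in> h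
      \<or> q \<in> h \<and> r \<in> h \<and> s \<in> h"
      unfolding gh g using z d by auto
    then show False unfolding h using d by auto
  qed
  obtain u v where uv: "g = {u, v}" "u \<noteq> v" using c by (auto simp: card_2_iff)
  have cases: "g = {p, q} \<or> g = {r, s} \<or> g = {p, r} \<or> g = {p, s} \<or> g = {q, r} \<or> g = {q, s}"
  proof -
    have "u \<in> {p, q, r, s}" "v \<in> {p, q, r, s}" using uv sub by auto
    then show ?thesis unfolding uv(1) using uv(2)
      by (elim insertE emptyE) (simp_all add: insert_commute)
  qed
  have E: "{p, q} \<in> E" "{r, s} \<in> E" using assms xy by auto
  have sym: "{y, x} \<in> E" if "{x, y} \<in> E" for x y using that by (simp add: insert_commute)
  have "\<not> (g = {p, r})"
  proof
    assume g: "g = {p, r}"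
    have "h = {q, s}" unfolding gh g using d by auto
    then have "{q, r} \<in> E"
      using four_cycle_chords(2)[of p q s r] g c E sym[OF E(1)] sym[OF E(2)] sym[of p r] sym[of q s] d by simp
    moreover have "Z \<triangle> A = {q, r}" unfolding ZA g using d by auto
    ultimately show False using assms by simp
  qed
  moreover have "\<not> (g = {p, s})"
  proof
    assume g: "g = {p, s}"
    have "h = {q, r}" unfolding gh g using d by auto
    then have "{q, s} \<in> E"
      using four_cycle_chords(2)[of p q r s] g c E sym[OF E(1)] sym[OF E(2)] sym[of p s] sym[of q r] d by simp
    moreover have "Z \<triangle> A = {q, s}" unfolding ZA g using d by auto
    ultimately show False using assms by simp
  qed
  moreover have "\<not> (g = {q, r})"
  proof
    assume g: "g = {q, r}"
    have "h = {p, s}" unfolding gh g using d by auto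
    then have "{p, r} \<in> E"
      using four_cycle_chords(1)[of p q r s] g c E sym[OF E(1)] sym[OF E(2)] sym[of p s] sym[of q r] d by simp
    moreover have "Z \<triangle> A = {p, r}" unfolding ZA g using d by auto
    ultimately show False using assms by simp
  qed
  moreover have "\<not> (g = {q, s})"
  proof
    assume g: "g = {q, s}"
    have "h = {p, r}" unfolding gh g using d by auto
    then have "{p, s} \<in> E"
      using four_cycle_chords(1)[of p q s r] g c E sym[OF E(1)] sym[OF E(2)] sym[of p r] sym[of q s] d by simp
    moreover have "Z \<triangle> A = {p, s}" unfolding ZA g using d by auto
    ultimately show False using assms by simp
  qed
  moreover have "g \<noteq> {p, q}" using ZA assms(6) by auto
  ultimately show ?thesis using cases Z xy by auto
qed

end

section \<open>Labels of moves under an automorphism of the token graph\<close>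

definition lab :: "('a set \<Rightarrow> 'a set) \<Rightarrow> 'a set \<Rightarrow> 'a set \<Rightarrow> 'a set" where
  "lab f A e = f A \<triangle> f (A \<triangle> e)"

lemma sd_lab: "f A \<triangle> lab f A e = f (A \<triangle> e)"
  by (simp add: lab_def)

lemma lab_back: "lab f (A \<triangle> e) e = lab f A e"
  unfolding lab_def sd_self_right by (rule sd_commute)

text \<open>The inverse \<open>g\<close> is a parameter, so that by \<open>inverse_token_aut\<close>
  every lemma can be reused with \<open>f\<close> and \<open>g\<close> exchanged.\<close>

locale token_aut = token_graph +
  fixes f g :: "'a set \<Rightarrow> 'a set"
  assumes f_TV: "A \<in> TV \<Longrightarrow> f A \<in> TV" and g_TV: "A \<in> TV \<Longrightarrow> g A \<in> TV"
    and g_f: "A \<in> TV \<Longrightarrow> g (f A) = A" and f_g: "A \<in> TV \<Longrightarrow> f (g A) = A"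
    and f_edge_iff: "A \<in> TV \<Longrightarrow> B \<in> TV \<Longrightarrow> f A \<triangle> f B \<in> E \<longleftrightarrow> A \<triangle> B \<in> E"
begin

lemma inverse_token_aut: "token_aut V E k g f"
proof
  fix A B assume "A \<in> TV" "B \<in> TV"
  then show "g A \<triangle> g B \<in> E \<longleftrightarrow> A \<triangle> B \<in> E"
    using f_edge_iff[of "g A" "g B"] by (simp add: g_TV f_g)
qed (simp_all add: f_TV g_TV g_f f_g)

lemma f_eq_iff: "A \<in> TV \<Longrightarrow> B \<in> TV \<Longrightarrow> f A = f B \<longleftrightarrow> A = B"
  using g_f by metis

lemma moves_lab: "moves A e \<Longrightarrow> moves (f A) (lab f A e)"
  using f_edge_iff[of A "A \<triangle> e"] unfolding moves_def sd_lab by (auto simp: f_TV lab_def)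

lemma lab_edge: "moves A e \<Longrightarrow> lab f A e \<in> E"
  using moves_lab moves_def by blast

lemma lab_inverse: "moves A e \<Longrightarrow> lab g (f A) (lab f A e) = e"
  unfolding lab_def by (simp add: g_f moves_def)

lemma lab_eq_iff: "moves A e \<Longrightarrow> moves A e' \<Longrightarrow> lab f A e = lab f A e' \<longleftrightarrow> e = e'"
  using lab_inverse by metis

text \<open>\<open>A \<triangle> e \<triangle> e'\<close> is adjacent to both
  \<open>A \<triangle> e\<close> and \<open>A \<triangle> e'\<close>, but neither equal nor adjacent
  to \<open>A\<close>. If the labels touched, its image would have to be \<open>f A\<close>; as they
  are disjoint, its image is the fourth corner of the square they span.\<close>

lemma disjoint_lab_square:
  assumes m: "moves A e" "moves A e'" and disj: "e \<inter> e' = {}"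
  shows "lab f A e \<inter> lab f A e' = {}" "f (A \<triangle> e \<triangle> e') = f A \<triangle> lab f A e \<triangle> lab f A e'"
proof -
  let ?Z = "A \<triangle> e \<triangle> e'"
  have e: "e \<in> E" "e' \<in> E" "A \<in> TV" "A \<triangle> e \<in> TV" "A \<triangle> e' \<in> TV" using m by (auto simp: moves_def)
  have Z: "?Z \<in> TV" using moves_disjoint[OF m(2) m(1)] disj by (auto simp: moves_def)
  have ce: "card e = 2" "card e' = 2" using e card_edge by auto
  have "e \<triangle> e' = e \<union> e'" using disj by auto
  moreover have "card (e \<union> e') = 4" using ce disj by (simp add: card_Un_disjoint card_ge_0_finite)
  ultimately have ne: "e \<triangle> e' \<notin> E" using card_edge by force
  have ee: "e \<noteq> e'" using disj ce by auto
  have lab: "moves (f A) (lab f A e)" "moves (f A) (lab f A e')" using m moves_lab by auto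
  then have lE: "lab f A e \<in> E" "lab f A e' \<in> E" by (auto simp: moves_def)
  have n1: "f ?Z \<triangle> (f A \<triangle> lab f A e) \<in> E"
    unfolding sd_lab using f_edge_iff[OF Z e(4)] e by (simp add: sd_ac)
  have n2: "f ?Z \<triangle> (f A \<triangle> lab f A e') \<in> E"
    unfolding sd_lab using f_edge_iff[OF Z e(5)] e by (simp add: sd_ac)
  have "?Z \<triangle> A = e \<triangle> e'" by (simp add: sd_ac)
  then have n3: "f ?Z \<triangle> f A \<notin> E" using f_edge_iff[OF Z e(3)] ne by simp
  have n4: "f ?Z \<noteq> f A" using f_eq_iff[OF Z e(3)] ee by (simp add: sd_assoc)
  show d: "lab f A e \<inter> lab f A e' = {}"
  proof (rule ccontr)
    assume t: "\<not> ?thesis"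
    obtain c b d where cbd: "lab f A e = {c, b}" "lab f A e' = {c, d}" "b \<noteq> d" "b \<noteq> c" "d \<noteq> c"
      using touching_pairs[OF card_edge[OF lE(1)] card_edge[OF lE(2)] _ t] lab_eq_iff[OF m] ee by metis
    \<comment> \<open>The two neighbours of \<open>A\<close> differ in four elements, so their
      images are not adjacent and \<open>{b, d}\<close> is not an edge.\<close>
    have "f (A \<triangle> e) \<triangle> f (A \<triangle> e') = lab f A e \<triangle> lab f A e'"
      by (simp add: lab_def sd_ac)
    also have "\<dots> = {b, d}" using cbd sd_pairs by metis
    finally have "{b, d} \<notin> E"
      using f_edge_iff[OF e(4,5)] ne by (simp add: sd_ac)
    then have "f ?Z = f A"
      using touching_moves_common_neighbour[of "f A" c b d "f ?Z"] cbd lab n1 n2 f_TV[OF Z] by simp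
    then show False using n4 by simp
  qed
  show "f ?Z = f A \<triangle> lab f A e \<triangle> lab f A e'"
    by (rule disjoint_moves_common_neighbour[OF lE d n1 n2 n4 n3])
qed

lemma lab_disjoint_iff:
  assumes "moves A e" "moves A e'"
  shows "lab f A e \<inter> lab f A e' = {} \<longleftrightarrow> e \<inter> e' = {}"
proof -
  interpret inv: token_aut V E k g f by (rule inverse_token_aut)
  show ?thesis
    using disjoint_lab_square(1)[OF assms] inv.disjoint_lab_square(1)[OF moves_lab moves_lab, OF assms]
    by (auto simp: lab_inverse assms)
qed

text \<open>The two labels sit on opposite sides of the square in
  \<open>disjoint_lab_square\<close>.\<close>

lemma lab_stable:
  assumes "moves A e" "moves A e'" "e \<inter> e' = {}"
  shows "lab f (A \<triangle> e') e = lab f A e"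
proof -
  have "lab f (A \<triangle> e') e = f (A \<triangle> e') \<triangle> f (A \<triangle> e \<triangle> e')"
    unfolding lab_def by (simp add: sd_ac)
  also have "\<dots> = f A \<triangle> lab f A e' \<triangle> (f A \<triangle> lab f A e \<triangle> lab f A e')"
    using disjoint_lab_square(2)[OF assms] by (simp add: sd_lab)
  also have "\<dots> = lab f A e" by (simp add: sd_ac)
  finally show ?thesis .
qed

text \<open>The moves along \<open>{c, a}\<close> and \<open>{b, d}\<close> span a square, and a
  move along \<open>{a, b}\<close> hangs at two opposite corners of it. The labels of these two
  moves meet both labels of the square; occupancy leaves two candidates, and the wrong one would
  yield an edge \<open>{c, d}\<close>. A chord \<open>{a, d}\<close> or \<open>{b, c}\<close> is
  allowed, which \<open>lab_independent\<close> relies on.\<close>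

lemma lab_path_middle:
  assumes "distinct [a, b, c, d]" "{a, b} \<in> E" "{c, a} \<in> E" "{b, d} \<in> E" "{c, d} \<notin> E"
    and A: "A \<in> TV" "a \<notin> A" "b \<in> A" "c \<in> A" "d \<notin> A"
  shows "lab f (A \<triangle> {c, a} \<triangle> {b, d}) {a, b} = lab f A {a, b}"
proof -
  let ?e = "{a, b}" and ?e1 = "{c, a}" and ?e3 = "{b, d}"
  let ?B = "A \<triangle> ?e1 \<triangle> ?e3"
  have m: "moves A ?e" "moves A ?e1" "moves A ?e3" using assms by (simp_all add: moves_pair)
  have d13: "?e1 \<inter> ?e3 = {}" using assms(1) by auto
  have B: "?B \<in> TV" using moves_disjoint[OF m(3,2)] d13 by (auto simp: moves_def)
  have mB: "moves ?B ?e" "moves ?B ?e1" "moves ?B ?e3" using assms B by (auto simp: moves_pair)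
  let ?x1 = "lab f A ?e1" and ?x3 = "lab f A ?e3" and ?x = "lab f A ?e" and ?y = "lab f ?B ?e"
  have xB: "lab f ?B ?e1 = ?x1" "lab f ?B ?e3 = ?x3"
  proof -
    have d31: "?e3 \<inter> ?e1 = {}" using d13 by auto
    have "moves (A \<triangle> ?e1) ?e1" "moves (A \<triangle> ?e1) ?e3"
      using moves_back[OF m(2)] moves_disjoint[OF m(3,2) d31] .
    then have "lab f ?B ?e1 = lab f (A \<triangle> ?e1) ?e1" using d13 by (rule lab_stable)
    then show "lab f ?B ?e1 = ?x1" by (simp only: lab_back)
    have "lab f ?B ?e3 = lab f (A \<triangle> ?e1) ?e3" by (rule lab_back)
    then show "lab f ?B ?e3 = ?x3" using lab_stable[OF m(3,2) d31] by simp
  qed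
  have disj: "?x1 \<inter> ?x3 = {}" using lab_disjoint_iff[OF m(2,3)] d13 by simp
  have t: "?x \<inter> ?x1 \<noteq> {}" "?x \<inter> ?x3 \<noteq> {}"
    using lab_disjoint_iff[OF m(1,2)] lab_disjoint_iff[OF m(1,3)] by auto
  have tB: "?y \<inter> ?x1 \<noteq> {}" "?y \<inter> ?x3 \<noteq> {}"
    using lab_disjoint_iff[OF mB(1,2)] lab_disjoint_iff[OF mB(1,3)] xB by auto
  have fm: "moves (f A) ?x" "moves (f A) ?x1" "moves (f A) ?x3" "moves (f ?B) ?y"
    using m mB moves_lab by auto
  have card: "card ?x = 2" "card ?x1 = 2" "card ?x3 = 2" "card ?y = 2"
    using fm card_edge by (auto simp: moves_def)
  obtain p where p: "p \<in> ?x" "p \<in> ?x1" using t by auto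
  obtain r where r: "r \<in> ?x" "r \<in> ?x3" using t by auto
  have pr: "p \<noteq> r" using disj p r by auto
  obtain q where q: "?x1 = {p, q}" "q \<noteq> p" by (rule pair_of_mem[OF card(2) p(2)])
  obtain s where s: "?x3 = {r, s}" "s \<noteq> r" by (rule pair_of_mem[OF card(3) r(2)])
  have x: "?x = {p, r}" using pair_of_mem[OF card(1) p(1)] r pr by (metis insertE singletonD)
  have dist: "distinct [p, q, r, s]" using disj q s pr by auto
  have opp: "(p \<in> f A) \<noteq> (q \<in> f A)" "(r \<in> f A) \<noteq> (s \<in> f A)" "(p \<in> f A) \<noteq> (r \<in> f A)"
    using fm q s x by (simp_all add: moves_pair)
  have fB: "f ?B = f A \<triangle> {p, q} \<triangle> {r, s}"
    using disjoint_lab_square(2)[OF m(2,3) d13] q s by simp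
  obtain u v where uv: "?y = {u, v}" "u \<in> {p, q}" "v \<in> {r, s}"
  proof -
    obtain u where u: "u \<in> ?y" "u \<in> ?x1" using tB by auto
    obtain v where v: "v \<in> ?y" "v \<in> ?x3" using tB by auto
    have "u \<noteq> v" using disj u v by auto
    then have "?y = {u, v}" using pair_of_mem[OF card(4) u(1)] v by (metis insertE singletonD)
    then show ?thesis using that u v q s by simp
  qed
  \<comment> \<open>At \<open>f A\<close> the vertices \<open>p\<close> and \<open>s\<close> have
    the same status, and so do \<open>q\<close> and \<open>r\<close>; passing to \<open>f ?B\<close>
    flips all four.\<close>
  have "(u \<in> f ?B) \<noteq> (v \<in> f ?B)" using fm(4) uv by (simp add: moves_pair)
  then have "u = p \<and> v = r \<or> u = q \<and> v = s"
    using uv(2,3) opp dist unfolding fB by auto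
  \<comment> \<open>Otherwise \<open>{q, s}\<close> is an edge along which \<open>f A\<close> can
    move. It is disjoint from \<open>{p, r}\<close> but touches \<open>{p, q}\<close> and
    \<open>{r, s}\<close>, so its preimage avoids \<open>a\<close> and \<open>b\<close> and meets
    \<open>{c, a}\<close> and \<open>{b, d}\<close>: it is \<open>{c, d}\<close>.\<close>
  moreover have "\<not> (u = q \<and> v = s)"
  proof
    assume "u = q \<and> v = s"
    then have qs: "{q, s} \<in> E" using uv(1) fm(4) by (simp add: moves_def)
    interpret inv: token_aut V E k g f by (rule inverse_token_aut)
    have mqs: "moves (f A) {q, s}" using qs opp f_TV[OF A(1)] by (auto simp: moves_pair)
    let ?e' = "lab g (f A) {q, s}"
    have m': "moves A ?e'" using inv.moves_lab[OF mqs] A by (simp add: g_f)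
    have "?e' \<inter> ?e = {}"
      using inv.lab_disjoint_iff[OF mqs fm(1)] dist unfolding lab_inverse[OF m(1)] unfolding x by auto
    moreover have "?e' \<inter> ?e1 \<noteq> {}"
      using inv.lab_disjoint_iff[OF mqs fm(2)] dist unfolding lab_inverse[OF m(2)] unfolding q(1) by auto
    moreover have "?e' \<inter> ?e3 \<noteq> {}"
      using inv.lab_disjoint_iff[OF mqs fm(3)] dist unfolding lab_inverse[OF m(3)] unfolding s(1) by auto
    ultimately have cd: "c \<in> ?e'" "d \<in> ?e'" by auto
    have "card ?e' = 2" "?e' \<in> E" using m' card_edge by (auto simp: moves_def)
    moreover obtain z where "?e' = {c, z}" by (rule pair_of_mem[OF \<open>card ?e' = 2\<close> cd(1)])
    ultimately show False using cd assms(1,5) by auto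
  qed
  ultimately show ?thesis using uv x by simp
qed

end

section \<open>Hexagons at a claw\<close>

text \<open>Two tokens on a claw with centre \<open>a\<close> run through a 6-cycle whose edges are labelled by the
  claw edges with period 3. Such cycles are indexed by all natural numbers, with period 6.\<close>

locale claw = token_graph +
  fixes a :: 'a and l :: "nat \<Rightarrow> 'a"
  assumes leaf_edge: "{a, l i} \<in> E" and leaf_period: "l (i + 3) = l i"
    and leaf_distinct: "l i \<noteq> l (i + 1)" and leaf_nonadjacent: "{l i, l (i + 1)} \<notin> E"
begin

text \<open>The occupancy conditions put the two tokens on \<open>a\<close> and
  \<open>l (i + 1)\<close> or on \<open>l i\<close> and \<open>l (i + 2)\<close>. Either way the
  move along \<open>{a, l i}\<close> is possible and leads to the same pattern shifted by
  one.\<close>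

definition hexagon :: "(nat \<Rightarrow> 'a set) \<Rightarrow> bool" where
  "hexagon u \<longleftrightarrow> (\<forall>i. u i \<in> TV \<and> u (i + 1) = u i \<triangle> {a, l i} \<and> (l i \<in> u i \<longleftrightarrow> a \<notin> u i)
     \<and> (l (i + 1) \<in> u i \<longleftrightarrow> a \<in> u i) \<and> (l (i + 2) \<in> u i \<longleftrightarrow> a \<notin> u i))"

lemma hexagonD:
  assumes "hexagon u"
  shows "u i \<in> TV" "u (i + 1) = u i \<triangle> {a, l i}" "l i \<in> u i \<longleftrightarrow> a \<notin> u i"
    "l (i + 1) \<in> u i \<longleftrightarrow> a \<in> u i" "l (i + 2) \<in> u i \<longleftrightarrow> a \<notin> u i"
  using assms unfolding hexagon_def by blast+

lemma leaf_distinct2: "l i \<noteq> l (i + 2)"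
  using leaf_distinct[of "i + 2"] leaf_period[of i] by (simp add: eval_nat_numeral)

lemma leaf_not_centre: "l i \<noteq> a" using leaf_edge[of i] edge_ends by blast

lemma leaf_in_V: "l i \<in> V" using leaf_edge[of i] edge_ends by blast

lemma centre_in_V: "a \<in> V" using leaf_edge edge_ends by blast

lemma hexagonI:
  assumes "u 0 \<in> TV" "\<And>i. u (i + 1) = u i \<triangle> {a, l i}"
    and "l 0 \<in> u 0 \<longleftrightarrow> a \<notin> u 0" "l 1 \<in> u 0 \<longleftrightarrow> a \<in> u 0" "l 2 \<in> u 0 \<longleftrightarrow> a \<notin> u 0"
  shows "hexagon u"
proof -
  have "u i \<in> TV \<and> (l i \<in> u i \<longleftrightarrow> a \<notin> u i) \<and> (l (i + 1) \<in> u i \<longleftrightarrow> a \<in> u i) \<and> (l (i + 2) \<in> u i \<longleftrightarrow> a \<notin> u i)" for i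
  proof (induction i)
    case 0
    then show ?case using assms by (simp add: eval_nat_numeral)
  next
    case (Suc i)
    have "moves (u i) {a, l i}" using Suc leaf_edge by (auto simp: moves_pair)
    then have "u (Suc i) \<in> TV" using assms(2)[of i] by (simp add: moves_def)
    moreover have "l (Suc i + 2) = l i" using leaf_period[of i] by (simp add: eval_nat_numeral)
    moreover have "x \<in> u (Suc i) \<longleftrightarrow> (x \<in> u i) \<noteq> (x \<in> {a, l i})" for x using assms(2)[of i] by simp
    ultimately show ?case
      using Suc leaf_distinct[of i] leaf_distinct2[of i] leaf_not_centre[of i] leaf_not_centre[of "i + 1"]
        leaf_not_centre[of "i + 2"] by auto
  qed
  then show ?thesis using assms(2) by (auto simp: hexagon_def)
qed

lemma hexagon_moves: "hexagon u \<Longrightarrow> moves (u i) {a, l i}" "hexagon u \<Longrightarrow> moves (u (i + 1)) {a, l i}"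
proof -
  assume h: "hexagon u"
  show m: "moves (u i) {a, l i}" using hexagonD[OF h] leaf_edge by (auto simp: moves_pair)
  show "moves (u (i + 1)) {a, l i}" using moves_back[OF m] hexagonD(2)[OF h] by simp
qed

text \<open>Six steps use each of the three claw edges twice, so everything cancels.\<close>

lemma hexagon_period:
  assumes h: "hexagon u"
  shows "u (i + 6) = u i"
proof -
  have "l (i + 3) = l i" "l (i + 4) = l (i + 1)" "l (i + 5) = l (i + 2)"
    using leaf_period[of i] leaf_period[of "i + 1"] leaf_period[of "i + 2"] by (simp_all add: add.commute)
  then show ?thesis
    using hexagonD(2)[OF h, of i] hexagonD(2)[OF h, of "i + 1"] hexagonD(2)[OF h, of "i + 2"]
      hexagonD(2)[OF h, of "i + 3"] hexagonD(2)[OF h, of "i + 4"] hexagonD(2)[OF h, of "i + 5"]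
    by (simp add: eval_nat_numeral sd_ac)
qed

text \<open>With \<open>leaf_nonadjacent\<close>, positions two apart are not adjacent;
  \<open>hexagon_step3\<close> gives the same for opposite positions.\<close>

lemma hexagon_step2: "hexagon u \<Longrightarrow> u i \<triangle> u (i + 2) = {l i, l (i + 1)}"
  using hexagonD(2)[of u i] hexagonD(2)[of u "i + 1"] sd_pairs[of "l i" "l (i + 1)" a]
    leaf_distinct[of i] leaf_not_centre
  by (simp add: sd_assoc eval_nat_numeral)

lemma hexagon_step3: "hexagon u \<Longrightarrow> u i \<triangle> u (i + 3) = {l i, l (i + 1), l (i + 2), a}"
proof -
  assume h: "hexagon u"
  have "u i \<triangle> u (i + 3) = {a, l i} \<triangle> {a, l (i + 1)} \<triangle> {a, l (i + 2)}"
    using hexagonD(2)[OF h, of i] hexagonD(2)[OF h, of "i + 1"] hexagonD(2)[OF h, of "i + 2"]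
    by (simp add: sd_assoc eval_nat_numeral)
  then show ?thesis
    using leaf_distinct[of i] leaf_distinct[of "i + 1"] leaf_distinct2[of i] leaf_not_centre
    by (auto simp: eval_nat_numeral)
qed

end

section \<open>The image of a hexagon\<close>

locale claw_aut = token_aut V E k f g + claw V E k a l
  for V :: "'a set" and E k f g a l
begin

text \<open>A single token or hole walks along \<open>m\<close> against the background
  \<open>B\<close>, and \<open>y\<close> is a vertex whose status in \<open>B\<close> is opposite to
  that of the walk. The induction follows a path from \<open>y\<close> to \<open>m 0\<close>,
  adapting hexagon and background, until the path enters the walk and a contradiction arises. If
  \<open>y = m 0\<close>, the status of \<open>y\<close> is already contradictory.\<close>

lemma claw_walk_transport:
  assumes path: "(adj E)\<^sup>*\<^sup>* y (m 0)"
    and m: "\<And>i. m i \<notin> {m (i + 1), m (i + 2), m (i + 3), m (i + 4)}"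
    and "hexagon u" "\<And>i. f (u i) = B \<triangle> {m i}" "y \<in> V" "y \<in> B \<longleftrightarrow> m 0 \<notin> B"
  shows False
  using path assms(3-)
proof (induction arbitrary: u B rule: converse_rtranclp_induct)
  case base
  then show False by blast
next
  case (step y z)
  interpret inv: token_aut V E k g f by (rule inverse_token_aut)
  note u = step.prems(1) and v = step.prems(2)
  define x where "x i = {m i, m (i + 1)}" for i :: nat
  have uV: "u i \<in> TV" for i using hexagonD(1)[OF u] .
  have vV: "f (u i) \<in> TV" for i using uV f_TV by blast
  have vx: "f (u (i + 1)) = f (u i) \<triangle> x i" for i
    using m[of i] unfolding v x_def by auto
  have x: "lab f (u i) {a, l i} = x i" for i
    using vx[of i] unfolding lab_def hexagonD(2)[OF u, symmetric] by simp
  have xm: "moves (f (u i)) (x i)" for i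
    using moves_lab[OF hexagon_moves(1)[OF u]] unfolding x by simp
  have gx: "lab g (f (u i)) (x i) = {a, l i}" for i
    using lab_inverse[OF hexagon_moves(1)[OF u]] unfolding x by simp
  \<comment> \<open>A move along \<open>{m i, m (i + 1)}\<close> is possible at
    \<open>B \<triangle> {m i}\<close>, so both vertices have the same status in
    \<open>B\<close>.\<close>
  have parity: "m i \<in> B \<longleftrightarrow> m 0 \<in> B" for i
  proof (induction i)
    case (Suc i)
    have "(m i \<in> B \<triangle> {m i}) \<noteq> (m (i + 1) \<in> B \<triangle> {m i})"
      using xm[of i] unfolding x_def moves_pair v by blast
    then show ?case using Suc m[of i] by auto
  qed simp
  have yz: "{y, z} \<in> E" using step.hyps by (simp add: adj_def)
  then have zV: "z \<in> V" "y \<noteq> z" using edge_ends by blast+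
  have ym: "y \<noteq> m i" for i using parity[of i] step.prems(4) by auto
  show False
  proof (cases "z \<in> B \<longleftrightarrow> m 0 \<in> B")
    \<comment> \<open>Here \<open>z\<close> already has the status of \<open>y\<close> and takes
      over its role without a move.\<close>
    case False
    then show False using step.IH[OF u v zV(1)] by blast
  next
    case zB: True
    have move: "moves (f (u i)) {y, z}" if "z \<noteq> m i" for i
      using that yz vV[of i] ym[of i] zB step.prems(4) unfolding moves_pair v by auto
    have stable: "lab g (f (u (i + 1))) {y, z} = lab g (f (u i)) {y, z}"
      "lab g (f (u i)) {y, z} \<inter> {a, l i} = {}"
      if "z \<noteq> m i" "z \<noteq> m (i + 1)" for i
    proof -
      have d: "{y, z} \<inter> x i = {}" using that ym unfolding x_def by auto
      show "lab g (f (u (i + 1))) {y, z} = lab g (f (u i)) {y, z}"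
        unfolding vx by (rule inv.lab_stable[OF move[OF that(1)] xm d])
      show "lab g (f (u i)) {y, z} \<inter> {a, l i} = {}"
        using inv.lab_disjoint_iff[OF move[OF that(1)] xm] d unfolding gx by simp
    qed
    show False
    proof (cases "z \<in> range m")
      case False
      then have zm: "z \<noteq> m i" for i by blast
      \<comment> \<open>Off the walk, \<open>{y, z}\<close> is disjoint from every label
        \<open>x i\<close>. Its preimage \<open>w\<close> is therefore the same at all positions and
        avoids the claw, so shifting by \<open>w\<close> gives a hexagon with background
        \<open>B \<triangle> {y, z}\<close>.\<close>
      define w where "w = lab g (f (u 0)) {y, z}"
      have w: "lab g (f (u i)) {y, z} = w" for i
      proof (induction i)
        case (Suc i)
        then show ?case using stable(1)[OF zm zm, of i] by simp
      qed (simp add: w_def)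
      have disj: "w \<inter> {a, l i} = {}" for i using stable(2)[OF zm zm, of i] w by simp
      have wm: "moves (u i) w" for i
        using inv.moves_lab[OF move[OF zm[of i]]] w g_f uV by simp
      have "lab f (u i) w = {y, z}" for i
        using inv.lab_inverse[OF move[OF zm[of i]]] w g_f uV by simp
      then have fw: "f (u i \<triangle> w) = B \<triangle> {y, z} \<triangle> {m i}" for i
        using sd_lab[of f "u i" w] v by (simp add: sd_ac)
      have "hexagon (\<lambda>i. u i \<triangle> w)"
      proof -
        have "a \<notin> w" "l i \<notin> w" for i using disj[of i] by auto
        moreover have "u i \<triangle> w \<in> TV" for i using wm by (simp add: moves_def)
        moreover have "u (i + 1) \<triangle> w = u i \<triangle> w \<triangle> {a, l i}" for i
          unfolding hexagonD(2)[OF u] by (simp add: sd_ac)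
        ultimately show ?thesis
          using hexagonD(3-5)[OF u] unfolding hexagon_def by auto
      qed
      moreover have "z \<in> B \<triangle> {y, z} \<longleftrightarrow> m 0 \<notin> B \<triangle> {y, z}"
        using zB ym[of 0] zm[of 0] by auto
      ultimately show False using step.IH[OF _ fw zV(1)] by blast
    next
      case True
      then obtain j where j: "z = m j" by blast
      have zm: "z \<noteq> m (j + 1)" "z \<noteq> m (j + 2)" "z \<noteq> m (j + 3)" "z \<noteq> m (j + 4)"
        using m[of j] j by auto
      \<comment> \<open>From position \<open>j + 1\<close> to \<open>j + 4\<close> three labels are
        passed, all disjoint from \<open>{y, z}\<close>. So the preimage \<open>w\<close> avoids
        \<open>a\<close> and all three leaves, in particular \<open>{a, l j}\<close>, whereas
        \<open>{y, z}\<close> touches \<open>x j\<close>.\<close>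
      define w where "w = lab g (f (u (j + 1))) {y, z}"
      have w2: "lab g (f (u (j + 2))) {y, z} = w" and d1: "w \<inter> {a, l (j + 1)} = {}"
        using stable[of "j + 1"] zm unfolding w_def by (simp_all add: eval_nat_numeral)
      have w3: "lab g (f (u (j + 3))) {y, z} = w" and d2: "w \<inter> {a, l (j + 2)} = {}"
        using stable[of "j + 2"] zm w2 by (simp_all add: eval_nat_numeral)
      have "w \<inter> {a, l (j + 3)} = {}"
        using stable(2)[of "j + 3"] zm w3 by (simp add: eval_nat_numeral)
      then have d3: "w \<inter> {a, l j} = {}" using leaf_period by simp
      have xj: "moves (f (u (j + 1))) (x j)" using moves_back[OF xm[of j]] unfolding vx .
      have "lab g (f (u (j + 1))) (x j) = {a, l j}"
        unfolding vx lab_back gx ..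
      then have "{y, z} \<inter> x j = {}"
        using inv.lab_disjoint_iff[OF move[OF zm(1)] xj] d3 unfolding w_def by simp
      then show False using j by (simp add: x_def)
    qed
  qed
qed

text \<open>Consecutive labels of the image touch. If three in a row share a vertex,
  \<open>star\<close> makes the next label equal to the first of them, and this spreads around the
  cycle. Otherwise the labels are the steps of a closed walk of length six, which
  \<open>claw_walk_transport\<close> excludes.\<close>

lemma claw_label:
  assumes u: "hexagon u"
  shows "lab f (u 3) {a, l 3} = lab f (u 0) {a, l 0}"
proof -
  define v where "v i = f (u i)" for i
  define x where "x i = lab f (u i) {a, l i}" for i
  have uV: "u i \<in> TV" for i using hexagonD(1)[OF u] .
  have vV: "v i \<in> TV" for i using uV f_TV v_def by simp
  have xm: "moves (v i) (x i)" for i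
    using moves_lab[OF hexagon_moves(1)[OF u]] by (simp add: x_def v_def)
  have xE: "x i \<in> E" for i using xm by (simp add: moves_def)
  have xc: "card (x i) = 2" for i using xE card_edge by blast
  have vx: "v (i + 1) = v i \<triangle> x i" for i
    unfolding v_def x_def sd_lab hexagonD(2)[OF u] ..
  have x_back: "lab f (u (i + 1)) {a, l i} = x i" for i
    unfolding x_def hexagonD(2)[OF u] by (rule lab_back)
  have touch: "x i \<inter> x (i + 1) \<noteq> {}" "x i \<noteq> x (i + 1)" for i
  proof -
    note m = hexagon_moves(2)[OF u, of i] hexagon_moves(1)[OF u, of "i + 1"]
    show "x i \<inter> x (i + 1) \<noteq> {}"
      using lab_disjoint_iff[OF m] unfolding x_back by (simp add: x_def)
    have "{a, l i} \<noteq> {a, l (i + 1)}" using leaf_distinct by (simp add: doubleton_eq_iff)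
    then show "x i \<noteq> x (i + 1)"
      using lab_eq_iff[OF m] unfolding x_back by (simp add: x_def)
  qed
  have v_period: "v (i + 6) = v i" for i using hexagon_period[OF u] by (simp add: v_def)
  have x_period: "x (i + 6) = x i" for i
    using vx[of i] vx[of "i + 6"] v_period[of i] v_period[of "i + 1"]
    by (simp add: add.commute)
  have v2: "v i \<triangle> v (i + 2) = x i \<triangle> x (i + 1)" for i
    using vx[of i] vx[of "i + 1"] by (simp add: sd_ac)
  have v3: "v i \<triangle> v (i + 3) = x i \<triangle> x (i + 1) \<triangle> x (i + 2)" for i
    using vx[of i] vx[of "i + 1"] vx[of "i + 2"] by (simp add: sd_ac eval_nat_numeral)
  \<comment> \<open>Positions two apart differ by two nonadjacent leaves, so their images are not
    adjacent either.\<close>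
  have tri: "x i \<triangle> x (i + 1) \<notin> E" for i
    using f_edge_iff[OF uV[of i] uV[of "i + 2"]] hexagon_step2[OF u, of i] leaf_nonadjacent[of i] v2[of i]
    by (simp add: v_def)
  have tri3: "x i \<triangle> x (i + 1) \<triangle> x (i + 2) \<notin> E" for i
  proof -
    have "distinct [l i, l (i + 1), l (i + 2), a]"
      using leaf_distinct[of i] leaf_distinct[of "i + 1"] leaf_distinct2[of i] leaf_not_centre
      by (auto simp: eval_nat_numeral)
    then have "card {l i, l (i + 1), l (i + 2), a} = 4" by simp
    then have "u i \<triangle> u (i + 3) \<notin> E" using card_edge hexagon_step3[OF u, of i] by fastforce
    then show ?thesis using f_edge_iff[OF uV[of i] uV[of "i + 3"]] v3[of i] by (simp add: v_def)
  qed
  have star: "x (i + 3) = x i" if m: "m \<in> x i" "m \<in> x (i + 1)" "m \<in> x (i + 2)" for i m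
  proof -
    obtain p where p: "x i = {m, p}" "p \<noteq> m" by (rule pair_of_mem[OF xc m(1)])
    obtain q where q: "x (i + 1) = {m, q}" "q \<noteq> m" by (rule pair_of_mem[OF xc m(2)])
    obtain r where r: "x (i + 2) = {m, r}" "r \<noteq> m" by (rule pair_of_mem[OF xc m(3)])
    have pq: "p \<noteq> q" using touch(2)[of i] p q by auto
    have qr: "q \<noteq> r" using touch(2)[of "i + 1"] q r by (auto simp: eval_nat_numeral)
    have pr: "p \<noteq> r" using tri3[of i] p q r xE[of "i + 1"] by (auto simp: sd_ac)
    let ?S = "{m, p, q, r}"
    have S: "x i \<triangle> x (i + 1) \<triangle> x (i + 2) = ?S"
      unfolding p q r using p(2) q(2) r(2) pq qr pr by auto
    \<comment> \<open>By the period 6, \<open>?S \<triangle> x (i + 3)\<close> equals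
      \<open>x (i + 4) \<triangle> x (i + 5)\<close>, a pair that is not an edge. This puts
      \<open>x (i + 3)\<close> inside \<open>?S\<close>, and of the six pairs there only
      \<open>{m, p}\<close> survives.\<close>
    have v4: "v i \<triangle> v (i + 4) = ?S \<triangle> x (i + 3)"
      using v3[of i] vx[of "i + 3"] S by (simp add: sd_assoc[symmetric] eval_nat_numeral)
    have v46: "v i \<triangle> v (i + 4) = x (i + 4) \<triangle> x (i + 5)"
      using v2[of "i + 4"] v_period[of i] by (simp add: sd_commute eval_nat_numeral)
    have nE: "?S \<triangle> x (i + 3) \<notin> E"
      using tri[of "i + 4"] v4 v46 by (simp add: eval_nat_numeral)
    have "card (x (i + 4) \<triangle> x (i + 5)) = 2"
    proof -
      obtain z b d where "x (i + 4) = {z, b}" "x (i + 5) = {z, d}" "b \<noteq> d" "b \<noteq> z" "d \<noteq> z"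
        using touching_pairs[OF xc xc touch(2) touch(1), of "i + 4"] by (auto simp: eval_nat_numeral)
      then show ?thesis using sd_pairs[of b d z] by simp
    qed
    then have c: "card (?S \<triangle> x (i + 3)) = 2" using v4 v46 by simp
    have sub: "x (i + 3) \<subseteq> ?S"
    proof -
      have fin: "finite (x (i + 3))" using xc[of "i + 3"] by (simp add: card_ge_0_finite)
      have "card (?S - x (i + 3)) \<le> card (?S \<triangle> x (i + 3))"
        using fin by (intro card_mono) (auto simp: sd_def)
      moreover have "card (?S - x (i + 3)) = card ?S - card (?S \<inter> x (i + 3))"
        by (rule card_Diff_subset_Int) simp
      moreover have "card ?S = 4" using p(2) q(2) r(2) pq qr pr by auto
      ultimately have "card (x (i + 3)) \<le> card (?S \<inter> x (i + 3))" using c xc[of "i + 3"] by linarith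
      then have "?S \<inter> x (i + 3) = x (i + 3)" using fin by (intro card_seteq) auto
      then show ?thesis by blast
    qed
    have t: "x (i + 3) \<inter> {m, r} \<noteq> {}" "x (i + 3) \<noteq> {m, r}"
      using touch[of "i + 2"] r by (auto simp: eval_nat_numeral)
    have n: "{m, r} \<triangle> x (i + 3) \<notin> E"
      using tri[of "i + 2"] r by (simp add: eval_nat_numeral)
    obtain s w where sw: "x (i + 3) = {s, w}" "s \<noteq> w" using xc[of "i + 3"] by (auto simp: card_2_iff)
    have "s \<in> ?S" "w \<in> ?S" using sub sw by auto
    then have "x (i + 3) = {m, p} \<or> x (i + 3) = {m, q} \<or> x (i + 3) = {m, r} \<or> x (i + 3) = {p, q}
        \<or> x (i + 3) = {p, r} \<or> x (i + 3) = {q, r}"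
      unfolding sw(1) using sw(2) by (elim insertE emptyE) (simp_all add: insert_commute)
    \<comment> \<open>From time \<open>i + 1\<close> to \<open>i + 3\<close> the status of
      \<open>m\<close> changes twice and that of \<open>q\<close> once, so both end up equal and no
      move along \<open>{m, q}\<close> is possible.\<close>
    moreover have "x (i + 3) \<noteq> {m, q}"
    proof
      assume *: "x (i + 3) = {m, q}"
      have "(m \<in> v (i + 1)) \<noteq> (q \<in> v (i + 1))" using xm[of "i + 1"] q by (simp add: moves_pair)
      moreover have "(m \<in> v (i + 3)) \<noteq> (q \<in> v (i + 3))" using xm[of "i + 3"] * by (simp add: moves_pair)
      moreover have "v (i + 3) = v (i + 1) \<triangle> {m, q} \<triangle> {m, r}"
        using vx[of "i + 1"] vx[of "i + 2"] q r by (simp add: eval_nat_numeral)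
      ultimately show False using q(2) r(2) qr by auto
    qed
    moreover have "x (i + 3) \<noteq> {p, q}" using t(1) p q r pq pr qr by auto
    moreover have "x (i + 3) \<noteq> {p, r}"
    proof
      assume *: "x (i + 3) = {p, r}"
      have "?S \<triangle> {p, r} = {m, q}" using p(2) q(2) r(2) pq qr pr by auto
      then show False using nE * xE[of "i + 1"] q by simp
    qed
    moreover have "x (i + 3) \<noteq> {q, r}"
    proof
      assume *: "x (i + 3) = {q, r}"
      have "{m, r} \<triangle> {q, r} = {m, q}" using q(2) r(2) qr by auto
      then show False using n * xE[of "i + 1"] q by simp
    qed
    ultimately show ?thesis using t(2) p by blast
  qed
  show ?thesis
  proof (cases "\<exists>i m. m \<in> x i \<and> m \<in> x (i + 1) \<and> m \<in> x (i + 2)")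
    case True
    then obtain i m where im: "m \<in> x i" "m \<in> x (i + 1)" "m \<in> x (i + 2)" by blast
    have "m \<in> x (i + j) \<and> m \<in> x (i + j + 1) \<and> m \<in> x (i + j + 2)" for j
    proof (induction j)
      case (Suc j)
      then show ?case using star[of m "i + j"] by (simp add: eval_nat_numeral)
    qed (use im in simp)
    then have "x (i + j + 3) = x (i + j)" for j using star by blast
    \<comment> \<open>This choice of \<open>j\<close> makes the index a multiple of the period 6,
      hence as good as 0.\<close>
    from this[of "5 * i"] have "x (6 * i + 3) = x (6 * i)" by simp
    moreover have "x (6 * i + j) = x j" for i j
    proof (induction i)
      case (Suc i)
      have "6 * Suc i + j = 6 * i + j + 6" by simp
      then show ?case using Suc x_period by metis
    qed simp
    from this[of i 3] this[of i 0] have "x (6 * i + 3) = x 3" "x (6 * i) = x 0" by simp_all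
    ultimately show ?thesis by (simp add: x_def)
  next
    case False
    \<comment> \<open>Modulo the period, \<open>i + 5\<close> stands for \<open>i - 1\<close>: the
      vertex \<open>m i\<close> is shared by a label and its predecessor.\<close>
    have "\<exists>z. z \<in> x (i + 5) \<and> z \<in> x i" for i
      using touch(1)[of "i + 5"] x_period[of i] by (auto simp: eval_nat_numeral)
    then obtain m where m: "m i \<in> x (i + 5)" "m i \<in> x i" for i by metis
    have m1: "m (i + 1) \<in> x i" for i using m(1)[of "i + 1"] x_period[of i] by (simp add: eval_nat_numeral)
    have mm: "m i \<noteq> m (i + 1)" for i
    proof
      assume "m i = m (i + 1)"
      moreover have "x (i + 5 + 1) = x i" "x (i + 5 + 2) = x (i + 1)"
        using x_period[of i] x_period[of "i + 1"] by (simp_all add: eval_nat_numeral)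
      ultimately show False using False m(1)[of i] m(2)[of i] m(2)[of "i + 1"] by metis
    qed
    have x: "x i = {m i, m (i + 1)}" for i
      using pair_of_mem[OF xc m(2)[of i]] m1[of i] mm[of i] by (metis insertE singletonD)
    \<comment> \<open>This is \<open>v 0\<close> with the walking token removed or the walking hole
      filled.\<close>
    define B where "B = v 0 \<triangle> {m 0}"
    have vB: "v i = B \<triangle> {m i}" for i
    proof (induction i)
      case (Suc i)
      have "v (Suc i) = B \<triangle> ({m i} \<triangle> {m i, m (i + 1)})" using vx[of i] x[of i] Suc by (simp add: sd_assoc)
      also have "{m i} \<triangle> {m i, m (i + 1)} = {m (i + 1)}" using mm[of i] by auto
      finally show ?case by simp
    qed (simp add: B_def)
    have m2: "m i \<noteq> m (i + 2)" for i
      using touch(2)[of i] x[of i] x[of "i + 1"] by (auto simp: eval_nat_numeral)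
    \<comment> \<open>Otherwise three consecutive labels form a triangle, against
      \<open>tri\<close>.\<close>
    have m3: "m i \<noteq> m (i + 3)" for i
    proof
      assume *: "m i = m (i + 3)"
      have "x i \<triangle> x (i + 1) = {m i, m (i + 2)}"
        unfolding x using mm[of i] mm[of "i + 1"] m2[of i] by (auto simp: eval_nat_numeral)
      also have "\<dots> = x (i + 2)" using * x[of "i + 2"] by (auto simp: eval_nat_numeral)
      finally show False using tri[of i] xE[of "i + 2"] by simp
    qed
    have m4: "m i \<noteq> m (i + 4)" for i
    proof -
      have "m (i + 6) = m i" using v_period[of i] vB[of i] vB[of "i + 6"] by simp
      then show ?thesis using m2[of "i + 4"] by (simp add: eval_nat_numeral)
    qed
    have dist: "m i \<notin> {m (i + 1), m (i + 2), m (i + 3), m (i + 4)}" for i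
      using mm[of i] m2[of i] m3[of i] m4[of i] by simp
    have mV: "m 0 \<in> V" using x[of 0] edge_subset[OF xE[of 0]] by blast
    \<comment> \<open>If no vertex has the other status, \<open>B\<close> is empty or all of
      \<open>V\<close>, so there is only one token or only one hole; but the claw carries two tokens
      and two empty vertices.\<close>
    have "\<exists>y \<in> V. y \<in> B \<longleftrightarrow> m 0 \<notin> B"
    proof (rule ccontr)
      assume no: "\<not> ?thesis"
      have BV: "B \<subseteq> V" using vV[of 0] mV by (auto simp: B_def TV_iff)
      have d: "distinct [a, l 0, l 1, l 2]"
        using leaf_distinct[of 0] leaf_distinct[of 1] leaf_distinct2[of 0] leaf_not_centre
        by (auto simp: eval_nat_numeral)
      have l: "l 0 \<in> u 0 \<longleftrightarrow> a \<notin> u 0" "l 1 \<in> u 0 \<longleftrightarrow> a \<in> u 0" "l 2 \<in> u 0 \<longleftrightarrow> a \<notin> u 0"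
        using hexagonD(3-5)[OF u, of 0] by (simp_all add: eval_nat_numeral)
      have fin: "finite (u 0)" using finite_TV uV by blast
      show False
      proof (cases "m 0 \<in> B")
        case True
        then have "B = V" using no BV by blast
        then have "v 0 = V - {m 0}" using vB[of 0] mV by (auto simp: sd_def)
        then have "card V = Suc (card (u 0))"
          using mV finite_V vV[of 0] uV[of 0] by (metis TV_iff card.remove)
        moreover have "\<exists>s t. s \<noteq> t \<and> {s, t} \<subseteq> V - u 0"
          using d l centre_in_V leaf_in_V[of 0] leaf_in_V[of 1] leaf_in_V[of 2]
          by (cases "a \<in> u 0") (auto intro: exI[of _ "l 0"] exI[of _ "l 2"] exI[of _ a] exI[of _ "l 1"])
        then obtain s t where st: "s \<noteq> t" "{s, t} \<subseteq> V - u 0" by blast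
        then have "card {s, t} \<le> card (V - u 0)" using finite_V by (intro card_mono) auto
        then have "2 \<le> card V - card (u 0)"
          using st fin uV[of 0] by (simp add: card_Diff_subset TV_iff)
        ultimately show False by linarith
      next
        case False
        then have "B = {}" using no BV by blast
        then have "card (u 0) = 1" using vB[of 0] vV[of 0] uV[of 0] by (simp add: TV_iff)
        moreover have "\<exists>s t. s \<noteq> t \<and> {s, t} \<subseteq> u 0"
          using d l
          by (cases "a \<in> u 0") (auto intro: exI[of _ "l 0"] exI[of _ "l 2"] exI[of _ a] exI[of _ "l 1"])
        then obtain s t where st: "s \<noteq> t" "{s, t} \<subseteq> u 0" by blast
        then have "card {s, t} \<le> card (u 0)" using fin by (intro card_mono) auto
        ultimately show False using st by simp
      qed
    qed
    then obtain y where y: "y \<in> V" "y \<in> B \<longleftrightarrow> m 0 \<notin> B" by blast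
    have "(adj E)\<^sup>*\<^sup>* y (m 0)" using connected y(1) mV by (simp add: connected_graph_def)
    then have False
      using claw_walk_transport[of y m u B] dist u vB y by (simp add: v_def)
    then show ?thesis ..
  qed
qed

end

section \<open>Independence of the label from the position\<close>

context token_aut
begin

lemma lab_claw:
  assumes dist: "distinct [a, b, c, d]" and edges: "{a, b} \<in> E" "{a, c} \<in> E" "{a, d} \<in> E"
    and nonadj: "{b, c} \<notin> E" "{b, d} \<notin> E" "{c, d} \<notin> E"
    and C: "C \<subseteq> V - {a, b, c, d}" "Suc (card C) = k - 1"
  shows "lab f (insert a (insert c C)) {a, b} = lab f (insert a (insert d C)) {a, b}"
proof -
  define l where "l i = (if i mod 3 = 0 then b else if i mod 3 = 1 then c else d)" for i :: nat
  have V: "a \<in> V" "c \<in> V" using edges edge_ends by blast+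
  have mod: "i mod 3 = 0 \<and> Suc i mod 3 = 1 \<or> i mod 3 = 1 \<and> Suc i mod 3 = 2 \<or> i mod 3 = 2 \<and> Suc i mod 3 = 0"
    for i :: nat by presburger
  interpret claw_aut V E k f g a l
  proof
    fix i
    show "{a, l i} \<in> E" using edges by (simp add: l_def)
    show "l (i + 3) = l i" by (simp add: l_def)
    show "l i \<noteq> l (i + 1)" using mod[of i] dist by (auto simp: l_def)
    show "{l i, l (i + 1)} \<notin> E" using mod[of i] nonadj by (auto simp: l_def insert_commute)
  qed
  define u where "u = rec_nat (insert a (insert c C)) (\<lambda>i S. S \<triangle> {a, l i})"
  have u0: "u 0 = insert a (insert c C)" and u_Suc: "u (Suc i) = u i \<triangle> {a, l i}" for i
    by (simp_all add: u_def)
  have "hexagon u"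
  proof (rule hexagonI)
    show "u 0 \<in> TV" unfolding u0 using C V dist by (intro TV_insert2) auto
  qed (use C dist in \<open>auto simp: u0 u_Suc l_def\<close>)
  then have "lab f (u 3) {a, b} = lab f (u 0) {a, b}"
    using claw_label[of u] by (simp add: l_def)
  \<comment> \<open>The tokens pass from \<open>a\<close>, \<open>c\<close> to \<open>b\<close>,
    \<open>c\<close>, then \<open>a\<close>, \<open>b\<close>, then \<open>b\<close>,
    \<open>d\<close>. Undoing a move along \<open>{a, b}\<close>, which keeps the label, leaves them
    on \<open>a\<close>, \<open>d\<close>.\<close>
  moreover have "u 3 = insert a (insert d C) \<triangle> {a, b}"
  proof -
    have "a \<notin> C" "b \<notin> C" "c \<notin> C" "d \<notin> C" using C by auto
    then have "x \<in> insert a (insert c C) \<triangle> {a, b} \<triangle> {a, c} \<triangle> {a, d} \<longleftrightarrow> x \<in> insert a (insert d C) \<triangle> {a, b}" for x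
      using dist by (cases "x = a"; cases "x = b"; cases "x = c"; cases "x = d") simp_all
    then have "insert a (insert c C) \<triangle> {a, b} \<triangle> {a, c} \<triangle> {a, d} = insert a (insert d C) \<triangle> {a, b}"
      by (rule set_eqI)
    moreover have "u 3 = u 0 \<triangle> {a, l 0} \<triangle> {a, l 1} \<triangle> {a, l 2}" by (simp add: eval_nat_numeral u_Suc)
    moreover have "l 0 = b" "l 1 = c" "l 2 = d" by (simp_all add: l_def)
    ultimately show ?thesis by (simp only: u0)
  qed
  ultimately show ?thesis by (simp only: lab_back u0)
qed

text \<open>With one token on \<open>e = {a, b}\<close>, the other \<open>k - 1\<close> tokens form
  a subset of \<open>W\<close> that alone determines the label, by \<open>lab_back\<close>. Applying
  \<open>token_transport\<close> on \<open>W\<close> reduces the claim to moving one of these tokens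
  between adjacent vertices or between two neighbours of \<open>e\<close>.\<close>

lemma lab_independent:
  assumes A: "moves A e" and B: "moves B e"
  shows "lab f A e = lab f B e"
proof -
  have "e \<in> E" using A by (simp add: moves_def)
  then obtain a b where e: "e = {a, b}" and ab: "{a, b} \<in> E" "a \<noteq> b"
    using card_edge[of e] by (auto simp: card_2_iff)
  have abV: "a \<in> V" "b \<in> V" using edge_ends[OF ab(1)] by auto
  define W where "W = V - {a, b}"
  define N where "N = {z. {a, z} \<in> E \<or> {b, z} \<in> E}"
  define h where "h C = lab f (insert a C) e" for C
  have h_b: "h C = lab f (insert b C) e" if "C \<subseteq> W" for C
  proof -
    have "insert b C = insert a C \<triangle> e" using that ab by (auto simp: W_def e)
    then show ?thesis by (simp add: h_def lab_back)
  qed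
  have h: "lab f S e = h (S - {a, b}) \<and> S - {a, b} \<subseteq> W \<and> card (S - {a, b}) = k - 1" if "moves S e" for S
  proof -
    have S: "S \<in> TV" "(a \<in> S) \<noteq> (b \<in> S)" using that by (auto simp: e moves_pair)
    have sub: "S - {a, b} \<subseteq> W" using S by (auto simp: W_def TV_iff)
    show ?thesis
    proof (cases "a \<in> S")
      case True
      then have *: "insert a (S - {a, b}) = S" "S - {a, b} = S - {a}" using S by auto
      then have "card (S - {a, b}) = k - 1" using True S(1) by (simp add: TV_iff finite_TV)
      moreover have "lab f S e = h (S - {a, b})" unfolding h_def *(1) ..
      ultimately show ?thesis using sub by simp
    next
      case False
      then have *: "insert b (S - {a, b}) = S" "S - {a, b} = S - {b}" using S by auto
      then have "card (S - {a, b}) = k - 1" using False S by (simp add: TV_iff finite_TV)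
      moreover have "lab f S e = h (S - {a, b})" unfolding h_b[OF sub] *(1) ..
      ultimately show ?thesis using sub by simp
    qed
  qed
  \<comment> \<open>Deleting \<open>a\<close> and \<open>b\<close> may disconnect the graph. Joining
    all neighbours of \<open>e\<close> repairs this: a passage through \<open>e\<close> becomes one
    step.\<close>
  let ?R = "\<lambda>c d. {c, d} \<in> E \<or> c \<in> N \<and> d \<in> N"
  have "h (A - {a, b}) = h (B - {a, b})"
  proof (rule token_transport[of W ?R "k - 1" h])
    show "finite W" using finite_V by (simp add: W_def)
  next
    fix c d assume cd: "c \<in> W" "d \<in> W"
    let ?R' = "\<lambda>c d. c \<in> W \<and> d \<in> W \<and> ?R c d"
    have "(adj E)\<^sup>*\<^sup>* c d" using connected cd by (simp add: connected_graph_def W_def)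
    \<comment> \<open>While the walk is inside \<open>e\<close>, the invariant keeps a neighbour of
      \<open>e\<close> in \<open>W\<close> that is reachable from \<open>c\<close>.\<close>
    then have "(d \<in> W \<longrightarrow> ?R'\<^sup>*\<^sup>* c d) \<and> (d \<in> {a, b} \<longrightarrow> (\<exists>m \<in> W \<inter> N. ?R'\<^sup>*\<^sup>* c m))"
    proof (induction rule: rtranclp_induct)
      case base
      then show ?case using cd(1) by (auto simp: W_def)
    next
      case (step z z')
      have zz: "{z, z'} \<in> E" using step by (simp add: adj_def)
      then have zV: "z \<in> V" "z' \<in> V" using edge_ends by blast+
      show ?case
      proof (cases "z \<in> W")
        case True
        then have zc: "?R'\<^sup>*\<^sup>* c z" using step by blast
        show ?thesis
        proof (cases "z' \<in> W")
          case True
          then have "?R' z z'" using \<open>z \<in> W\<close> zz by simp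
          then have "?R'\<^sup>*\<^sup>* c z'" using zc by (rule rtranclp.rtrancl_into_rtrancl[rotated])
          then show ?thesis using True by (auto simp: W_def)
        next
          case False
          then have "z' \<in> {a, b}" using zV by (auto simp: W_def)
          then have "z \<in> N" using zz by (auto simp: N_def insert_commute)
          then show ?thesis using zc \<open>z \<in> W\<close> False by blast
        qed
      next
        case False
        then have zab: "z \<in> {a, b}" using zV by (auto simp: W_def)
        then obtain m where m: "m \<in> W" "m \<in> N" "?R'\<^sup>*\<^sup>* c m" using step by blast
        show ?thesis
        proof (cases "z' \<in> W")
          case True
          have "z' \<in> N" using zz zab by (auto simp: N_def)
          then have "?R' m z'" using m True by simp
          then have "?R'\<^sup>*\<^sup>* c z'" using m(3) by (rule rtranclp.rtrancl_into_rtrancl[rotated])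
          then show ?thesis using True by (auto simp: W_def)
        next
          case False
          then show ?thesis using m by blast
        qed
      qed
    qed
    then show "?R'\<^sup>*\<^sup>* c d" using cd by blast
  next
    fix C c d assume C: "C \<subseteq> W" "Suc (card C) = k - 1" and c: "c \<in> W - C" and d: "d \<in> W - C"
      and cd: "c \<noteq> d" and R: "?R c d"
    have CV: "C \<subseteq> V" and V: "a \<in> V - C" "b \<in> V - C" "c \<in> V - C" "d \<in> V - C"
      using C c d abV by (auto simp: W_def)
    have dist: "distinct [a, b, c, d]" using c d cd ab by (auto simp: W_def)
    have sub: "insert c C \<subseteq> W" "insert d C \<subseteq> W" using C c d by auto
    have path: "h (insert x C) = h (insert y C)"
      if "distinct [a, b, x, y]" "x \<in> W - C" "y \<in> W - C" "{x, a} \<in> E" "{b, y} \<in> E" "{x, y} \<notin> E" for x y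
    proof -
      let ?A = "insert b (insert x C)"
      have xV: "x \<in> V - C" using that by (auto simp: W_def)
      have A: "?A \<in> TV" using TV_insert2[OF CV C(2) V(2) xV] that(1) by auto
      have "a \<notin> ?A" "b \<in> ?A" "x \<in> ?A" "y \<notin> ?A" using that C by (auto simp: W_def)
      then have "lab f (?A \<triangle> {x, a} \<triangle> {b, y}) e = lab f ?A e"
        unfolding e using lab_path_middle[OF that(1) ab(1) that(4-6) A] by blast
      moreover have "?A \<triangle> {x, a} \<triangle> {b, y} = insert a (insert y C)" using that C by (auto simp: W_def)
      moreover have "insert x C \<subseteq> W" using that C by auto
      ultimately show ?thesis using h_b[of "insert x C"] by (simp add: h_def)
    qed
    show "h (insert c C) = h (insert d C)"
    proof (cases "{c, d} \<in> E")
      case True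
      let ?A = "insert a (insert c C)"
      have A: "?A \<in> TV" using TV_insert2[OF CV C(2) V(1,3)] dist by auto
      have "moves ?A e" "moves ?A {c, d}" "e \<inter> {c, d} = {}"
        using A True ab V dist by (auto simp: moves_pair e)
      then have "lab f (?A \<triangle> {c, d}) e = lab f ?A e" by (rule lab_stable)
      moreover have "?A \<triangle> {c, d} = insert a (insert d C)" using V dist by auto
      ultimately show ?thesis by (simp add: h_def)
    next
      case False
      then have N: "{a, c} \<in> E \<or> {b, c} \<in> E" "{a, d} \<in> E \<or> {b, d} \<in> E" using R by (auto simp: N_def)
      \<comment> \<open>Either \<open>c\<close> and \<open>d\<close> hang at different ends of
        \<open>e\<close>, which becomes the middle of a path, or both are attached to the same end
        only, the centre of an induced claw.\<close>
      consider "{c, a} \<in> E" "{b, d} \<in> E" | "{d, a} \<in> E" "{b, c} \<in> E"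
        | "{a, c} \<in> E" "{a, d} \<in> E" "{b, c} \<notin> E" "{b, d} \<notin> E"
        | "{b, c} \<in> E" "{b, d} \<in> E" "{a, c} \<notin> E" "{a, d} \<notin> E"
        using N by (auto simp: insert_commute)
      then show ?thesis
      proof cases
        case 1
        then show ?thesis using path[of c d] dist c d False by simp
      next
        case 2
        have "{d, c} \<notin> E" using False by (simp add: insert_commute)
        then have "h (insert d C) = h (insert c C)" using path[of d c] dist c d 2 cd[symmetric] by simp
        then show ?thesis by (rule sym)
      next
        case 3
        have "C \<subseteq> V - {a, b, c, d}" using C c d by (auto simp: W_def)
        then show ?thesis
          unfolding h_def e using lab_claw[OF dist ab(1) 3(1,2,3,4) False _ C(2)] by blast
      next
        case 4
        have "C \<subseteq> V - {b, a, c, d}" "distinct [b, a, c, d]" using C c d dist by (auto simp: W_def)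
        then have "lab f (insert b (insert c C)) {b, a} = lab f (insert b (insert d C)) {b, a}"
          using lab_claw[of b a c d C] ab(1) 4 False C(2) by (simp add: insert_commute)
        then show ?thesis unfolding h_b[OF sub(1)] h_b[OF sub(2)] by (simp add: e insert_commute)
      qed
    qed
  qed (use h[OF A] h[OF B] in blast)+
  then show ?thesis using h[OF A] h[OF B] by simp
qed

end

section \<open>The map on edges\<close>

context token_graph
begin

text \<open>For a token automorphism the choice of \<open>A\<close> does not matter, by
  \<open>lab_independent\<close>.\<close>

definition edge_map :: "('a set \<Rightarrow> 'a set) \<Rightarrow> 'a set \<Rightarrow> 'a set" where
  "edge_map f e = lab f (SOME A. moves A e) e"

lemma card_V: "2 \<le> card V"
  using k_pos k_less by linarith

text \<open>Put a token on \<open>a\<close> and none on \<open>b\<close>, \<open>d\<close>. If the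
  other tokens then lack room, \<open>k = card V - 1\<close> and \<open>a\<close> can be the only
  hole. The case \<open>b = d\<close> serves \<open>ex_moves\<close>.\<close>

lemma ex_common_moves:
  assumes "{a, b} \<in> E" "{a, d} \<in> E"
  shows "\<exists>A. moves A {a, b} \<and> moves A {a, d}"
proof -
  have V: "a \<in> V" "b \<in> V" "d \<in> V" "a \<noteq> b" "a \<noteq> d" using assms edge_ends by auto
  have "\<exists>A \<in> TV. (a \<in> A \<longleftrightarrow> b \<notin> A) \<and> (a \<in> A \<longleftrightarrow> d \<notin> A)"
  proof (cases "k - 1 \<le> card (V - {a, b, d})")
    case True
    then obtain C where C: "C \<subseteq> V - {a, b, d}" "card C = k - 1" "finite C"
      by (rule obtain_subset_with_card_n)
    then have "a \<notin> C" "C \<subseteq> V" by auto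
    then have "insert a C \<in> TV" using C V k_pos by (simp add: TV_iff)
    then show ?thesis using C V by (intro bexI[of _ "insert a C"]) auto
  next
    case False
    have "card (V - {a, b, d}) \<ge> card V - card {a, b, d}" by (rule diff_card_le_card_Diff) simp
    moreover have "card {a, b, d} \<le> 3" by (simp add: card_insert_if)
    ultimately have "card V - 1 = k" using False k_less by linarith
    then have "V - {a} \<in> TV" using V finite_V by (simp add: TV_iff)
    then show ?thesis using V by (intro bexI[of _ "V - {a}"]) auto
  qed
  then show ?thesis using assms by (auto simp: moves_pair)
qed

lemma ex_moves:
  assumes "e \<in> E"
  shows "\<exists>A. moves A e"
proof -
  obtain a b where "e = {a, b}" using card_edge[OF assms] by (auto simp: card_2_iff)
  then show ?thesis using ex_common_moves[of a b b] assms by simp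
qed

lemma ex_neighbour:
  assumes "v \<in> V"
  obtains w where "{v, w} \<in> E"
proof -
  have "V \<noteq> {v}" using card_V by auto
  then obtain z where "z \<in> V" "z \<noteq> v" using assms by blast
  then have "(adj E)\<^sup>*\<^sup>* v z" using connected assms by (simp add: connected_graph_def)
  then show ?thesis using \<open>z \<noteq> v\<close> that by (cases rule: converse_rtranclpE) (auto simp: adj_def)
qed

definition branching :: "'a \<Rightarrow> bool" where
  "branching v \<longleftrightarrow> (\<exists>w w'. w \<noteq> w' \<and> {v, w} \<in> E \<and> {v, w'} \<in> E)"

end

section \<open>The automorphism of the graph behind the edge map\<close>

context token_aut
begin

abbreviation "G \<equiv> edge_map f"

lemma edge_map_lab: "moves A e \<Longrightarrow> lab f A e = G e"
  unfolding edge_map_def by (rule lab_independent) (auto intro: someI)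

lemma edge_map_edge: "e \<in> E \<Longrightarrow> G e \<in> E"
  using ex_moves edge_map_lab lab_edge by metis

lemma edge_map_inverse: "e \<in> E \<Longrightarrow> edge_map g (G e) = e"
proof -
  assume "e \<in> E"
  then obtain A where A: "moves A e" using ex_moves by blast
  interpret inv: token_aut V E k g f by (rule inverse_token_aut)
  show ?thesis using inv.edge_map_lab[OF moves_lab[OF A]] lab_inverse[OF A] edge_map_lab[OF A] by simp
qed

text \<open>Both moves start from one \<open>A\<close>. Their targets differ by
  \<open>{b, d}\<close> and the images of the targets by the difference of the two labels, so
  triangles correspond to triangles.\<close>

lemma edge_map_touching:
  assumes "{a, b} \<in> E" "{a, d} \<in> E"
  shows "G {a, b} \<inter> G {a, d} \<noteq> {}" "b \<noteq> d \<Longrightarrow> G {a, b} \<noteq> G {a, d}"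
    "b \<noteq> d \<Longrightarrow> G {a, b} \<triangle> G {a, d} \<in> E \<longleftrightarrow> {b, d} \<in> E"
    "{b, d} \<in> E \<Longrightarrow> G {b, d} = G {a, b} \<triangle> G {a, d}"
proof -
  obtain A where A: "moves A {a, b}" "moves A {a, d}" using ex_common_moves assms by blast
  have l: "lab f A {a, b} = G {a, b}" "lab f A {a, d} = G {a, d}" using A edge_map_lab by auto
  have ne: "a \<noteq> b" "a \<noteq> d" using assms edge_ends by blast+
  show "G {a, b} \<inter> G {a, d} \<noteq> {}" using lab_disjoint_iff[OF A] l by auto
  show "G {a, b} \<noteq> G {a, d}" if "b \<noteq> d"
    using lab_eq_iff[OF A] l that ne by (auto simp: doubleton_eq_iff)
  have G: "G {a, b} \<triangle> G {a, d} = f (A \<triangle> {a, b}) \<triangle> f (A \<triangle> {a, d})"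
    unfolding l[symmetric] lab_def by (simp add: sd_ac)
  have bd: "(A \<triangle> {a, b}) \<triangle> (A \<triangle> {a, d}) = {b, d}" if "b \<noteq> d"
  proof -
    have "(A \<triangle> {a, b}) \<triangle> (A \<triangle> {a, d}) = {a, b} \<triangle> {a, d}" by (simp add: sd_ac)
    then show ?thesis using sd_pairs[of b d a] that ne by simp
  qed
  have TV: "A \<triangle> {a, b} \<in> TV" "A \<triangle> {a, d} \<in> TV" using A by (auto simp: moves_def)
  show "G {a, b} \<triangle> G {a, d} \<in> E \<longleftrightarrow> {b, d} \<in> E" if "b \<noteq> d"
    using f_edge_iff[OF TV] G bd[OF that] by simp
  show "G {b, d} = G {a, b} \<triangle> G {a, d}" if E: "{b, d} \<in> E"
  proof -
    have "b \<noteq> d" using E edge_ends by blast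
    have *: "A \<triangle> {a, b} \<triangle> {b, d} = A \<triangle> {a, d}"
      unfolding bd[OF \<open>b \<noteq> d\<close>, symmetric] by simp
    then have "moves (A \<triangle> {a, b}) {b, d}" using E TV by (simp add: moves_def)
    then have "G {b, d} = lab f (A \<triangle> {a, b}) {b, d}" using edge_map_lab by simp
    also have "\<dots> = f (A \<triangle> {a, b}) \<triangle> f (A \<triangle> {a, d})" by (simp only: lab_def *)
    finally show ?thesis using G by simp
  qed
qed

text \<open>Two labels at \<open>v\<close> meet in a single vertex \<open>x\<close>. A third label
  avoiding \<open>x\<close> would close a triangle with them; then \<open>{b, d}\<close> is an edge
  with that same label, against injectivity. This excludes the exchange of claw and triangle known
  from Whitney's theorem.\<close>

lemma star_image:
  assumes "branching v"
  obtains x where "\<And>w. {v, w} \<in> E \<Longrightarrow> x \<in> G {v, w}"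
    "\<And>y. (\<And>w. {v, w} \<in> E \<Longrightarrow> y \<in> G {v, w}) \<Longrightarrow> y = x"
proof -
  obtain b d where bd: "b \<noteq> d" "{v, b} \<in> E" "{v, d} \<in> E" using assms by (auto simp: branching_def)
  note t = edge_map_touching[OF bd(2,3)]
  have c: "card (G {v, b}) = 2" "card (G {v, d}) = 2" using bd edge_map_edge card_edge by auto
  obtain x p q where x: "G {v, b} = {x, p}" "G {v, d} = {x, q}" "p \<noteq> q" "p \<noteq> x" "q \<noteq> x"
    by (rule touching_pairs[OF c t(2)[OF bd(1)] t(1)])
  have "x \<in> G {v, w}" if w: "{v, w} \<in> E" for w
  proof (rule ccontr)
    assume nx: "x \<notin> G {v, w}"
    have "w \<noteq> b" "w \<noteq> d" using nx x by auto
    have pq: "p \<in> G {v, w}" "q \<in> G {v, w}"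
      using edge_map_touching(1)[OF bd(2) w] edge_map_touching(1)[OF bd(3) w] nx x by auto
    have "card (G {v, w}) = 2" using w edge_map_edge card_edge by auto
    then have Gw: "G {v, w} = {p, q}" using pair_of_mem[OF _ pq(1)] pq(2) x(3) by (metis insertE singletonD)
    also have "\<dots> = G {v, b} \<triangle> G {v, d}" unfolding x using sd_pairs[of p q x] x by simp
    finally have *: "G {v, w} = G {v, b} \<triangle> G {v, d}" .
    then have "{b, d} \<in> E" using t(3)[OF bd(1)] edge_map_edge[OF w] by simp
    then have "G {b, d} = G {v, w}" using t(4) * by simp
    then have "{b, d} = {v, w}" using edge_map_inverse[OF w] edge_map_inverse[OF \<open>{b, d} \<in> E\<close>] by simp
    then show False using bd edge_ends[OF bd(2)] edge_ends[OF bd(3)] by (auto simp: doubleton_eq_iff)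
  qed
  moreover have "y = x" if "\<And>w. {v, w} \<in> E \<Longrightarrow> y \<in> G {v, w}" for y
    using that[OF bd(2)] that[OF bd(3)] x by auto
  ultimately show ?thesis using that by blast
qed

text \<open>A branching vertex goes to the common vertex \<open>c v\<close> of its labels. A vertex
  of degree one has a branching neighbour and goes to the end of its label which that neighbour
  leaves free.\<close>

lemma edge_map_vertex_map:
  assumes nontrivial: "\<And>v w. {v, w} \<in> E \<Longrightarrow> branching v \<or> branching w"
  obtains s where "\<And>v w. {v, w} \<in> E \<Longrightarrow> G {v, w} = {s v, s w}"
proof -
  have "\<exists>x. branching v \<longrightarrow> (\<forall>w. {v, w} \<in> E \<longrightarrow> x \<in> G {v, w})
      \<and> (\<forall>y. (\<forall>w. {v, w} \<in> E \<longrightarrow> y \<in> G {v, w}) \<longrightarrow> y = x)" for v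
  proof (cases "branching v")
    case True
    show ?thesis by (rule star_image[OF True]) blast
  qed simp
  then obtain c where c: "\<And>v w. branching v \<Longrightarrow> {v, w} \<in> E \<Longrightarrow> c v \<in> G {v, w}"
    and c_unique: "\<And>v y. branching v \<Longrightarrow> (\<And>w. {v, w} \<in> E \<Longrightarrow> y \<in> G {v, w}) \<Longrightarrow> y = c v"
    by metis
  \<comment> \<open>If \<open>c v = c w\<close>, further edges \<open>{v, z}\<close> and
    \<open>{w, t}\<close> have touching labels, hence touch, so \<open>z = t\<close>. In the
    triangle \<open>v\<close>, \<open>w\<close>, \<open>z\<close> the label of \<open>{w, z}\<close>
    is the difference of two sets containing \<open>c v\<close> and misses it.\<close>
  have c_distinct: "c v \<noteq> c w" if vw: "{v, w} \<in> E" "branching v" "branching w" for v w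
  proof
    assume eq: "c v = c w"
    have wv: "{w, v} \<in> E" using vw by (simp add: insert_commute)
    obtain z where z: "{v, z} \<in> E" "z \<noteq> w" using vw(2) unfolding branching_def by metis
    obtain t where t: "{w, t} \<in> E" "t \<noteq> v" using vw(3) unfolding branching_def by metis
    interpret inv: token_aut V E k g f by (rule inverse_token_aut)
    have "c v \<in> G {v, z} \<inter> G {w, t}" using c[OF vw(2) z(1)] c[OF vw(3) t(1)] by (simp add: eq)
    moreover obtain p q where p: "G {v, z} = {c v, p}" and q: "G {w, t} = {c v, q}"
      using pair_of_mem[OF card_edge[OF edge_map_edge]] z t calculation by (metis IntE)
    ultimately have "edge_map g {c v, p} \<inter> edge_map g {c v, q} \<noteq> {}"
      using inv.edge_map_touching(1)[of "c v" p q] edge_map_edge[OF z(1)] edge_map_edge[OF t(1)] by simp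
    then have "{v, z} \<inter> {w, t} \<noteq> {}"
      using edge_map_inverse[OF z(1)] edge_map_inverse[OF t(1)] p q by simp
    then have "z = t" using z t edge_ends[OF vw(1)] by auto
    have wz: "{w, z} \<in> E" using t \<open>z = t\<close> by simp
    then have "G {w, z} = G {v, w} \<triangle> G {v, z}" using edge_map_touching(4)[OF vw(1) z(1)] by simp
    then have "c v \<notin> G {w, z}" using c[OF vw(2) vw(1)] c[OF vw(2) z(1)] by simp
    then show False using c[OF vw(3) wz] eq by simp
  qed
  have "\<exists>x. \<forall>w. {v, w} \<in> E \<longrightarrow> x \<in> G {v, w} \<and> (branching w \<longrightarrow> x \<noteq> c w)" for v
  proof (cases "branching v")
    case True
    then show ?thesis using c c_distinct by blast
  next
    case False
    show ?thesis
    proof (cases "\<exists>w. {v, w} \<in> E")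
      case True
      then obtain w where w: "{v, w} \<in> E" by blast
      have only: "w' = w" if "{v, w'} \<in> E" for w' using False that w by (auto simp: branching_def)
      have "{w, v} \<in> E" using w by (simp add: insert_commute)
      then have "c w \<in> G {v, w}" using c[of w v] nontrivial[OF w] False by (auto simp: insert_commute)
      then obtain x where "G {v, w} = {c w, x}" "x \<noteq> c w"
        by (rule pair_of_mem[OF card_edge[OF edge_map_edge[OF w]]])
      then show ?thesis using only by (intro exI[of _ x]) auto
    next
      case False
      then show ?thesis by blast
    qed
  qed
  then obtain s where s: "\<And>v w. {v, w} \<in> E \<Longrightarrow> s v \<in> G {v, w}"
    "\<And>v w. {v, w} \<in> E \<Longrightarrow> branching w \<Longrightarrow> s v \<noteq> c w" by metis
  have sc: "s v = c v" if "branching v" for v using c_unique[OF that] s(1) by blast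
  have "G {v, w} = {s v, s w}" if vw: "{v, w} \<in> E" for v w
  proof -
    have wv: "{w, v} \<in> E" using vw by (simp add: insert_commute)
    have ne: "s v \<noteq> s w" using nontrivial[OF vw] s(2)[OF vw] s(2)[OF wv] sc by metis
    have "s v \<in> G {v, w}" "s w \<in> G {v, w}" using s(1)[OF vw] s(1)[OF wv] by (simp_all add: insert_commute)
    then show ?thesis
      using pair_of_mem[OF card_edge[OF edge_map_edge[OF vw]]] ne by (metis insertE singletonD)
  qed
  then show ?thesis using that by blast
qed

text \<open>The composition maps every edge to itself. A branching vertex is fixed as the only
  common vertex of two edges; a vertex of degree one is fixed because its neighbour is.\<close>

lemma vertex_maps_inverse:
  assumes nontrivial: "\<And>v w. {v, w} \<in> E \<Longrightarrow> branching v \<or> branching w"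
    and s: "\<And>v w. {v, w} \<in> E \<Longrightarrow> G {v, w} = {s v, s w}"
    and t: "\<And>v w. {v, w} \<in> E \<Longrightarrow> edge_map g {v, w} = {t v, t w}"
    and v: "v \<in> V"
  shows "s v \<in> V" "t (s v) = v"
proof -
  have ts: "{t (s v), t (s w)} = {v, w}" if "{v, w} \<in> E" for v w
    using edge_map_inverse[OF that] edge_map_edge[OF that] s[OF that] t[of "s v" "s w"] by simp
  have br: "t (s v) = v" if v: "branching v" for v
  proof -
    obtain b d where "b \<noteq> d" "{v, b} \<in> E" "{v, d} \<in> E" using v unfolding branching_def by blast
    then show ?thesis using ts[of v b] ts[of v d] by (auto simp: doubleton_eq_iff)
  qed
  obtain w where w: "{v, w} \<in> E" using ex_neighbour[OF v] .
  show "s v \<in> V" using edge_map_edge[OF w] edge_subset s[OF w] by auto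
  show "t (s v) = v" using nontrivial[OF w] br[of v] br[of w] ts[OF w] by (auto simp: doubleton_eq_iff)
qed

lemma edge_map_automorphism:
  obtains s where "graph_aut V E s" "\<And>e. e \<in> E \<Longrightarrow> G e = s ` e"
proof (cases "\<forall>v w. {v, w} \<in> E \<longrightarrow> branching v \<or> branching w")
  case True
  then have nt: "\<And>v w. {v, w} \<in> E \<Longrightarrow> branching v \<or> branching w" by blast
  interpret inv: token_aut V E k g f by (rule inverse_token_aut)
  obtain s where s: "\<And>v w. {v, w} \<in> E \<Longrightarrow> G {v, w} = {s v, s w}"
    using edge_map_vertex_map[OF nt] by blast
  obtain t where t: "\<And>v w. {v, w} \<in> E \<Longrightarrow> edge_map g {v, w} = {t v, t w}"
    using inv.edge_map_vertex_map[OF nt] by blast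
  note st = vertex_maps_inverse[OF nt s t] and ts = inv.vertex_maps_inverse[OF nt t s]
  have "bij_betw s V V"
    by (rule bij_betw_byWitness[of _ t]) (use st ts in auto)
  moreover have "{u, v} \<in> E \<longleftrightarrow> {s u, s v} \<in> E" if "u \<in> V" "v \<in> V" for u v
    using s[of u v] t[of "s u" "s v"] edge_map_edge[of "{u, v}"] inv.edge_map_edge[of "{s u, s v}"] st that
    by auto
  ultimately have "graph_aut V E s" by (simp add: graph_aut_def graph_iso_def)
  moreover have "G e = s ` e" if "e \<in> E" for e
    using that card_edge[OF that] s by (auto simp: card_2_iff)
  ultimately show ?thesis using that by blast
next
  case False
  \<comment> \<open>By connectedness this edge is the whole graph, and \<open>id\<close> induces the
    only possible edge map.\<close>
  then obtain v w where vw: "{v, w} \<in> E" and nb: "\<not> branching v" "\<not> branching w" by blast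
  have wv: "{w, v} \<in> E" using vw by (simp add: insert_commute)
  have only: "x = w" if "{v, x} \<in> E" for x using nb(1) that vw by (auto simp: branching_def)
  have only': "x = v" if "{w, x} \<in> E" for x using nb(2) that wv by (auto simp: branching_def)
  have V: "z \<in> {v, w}" if "z \<in> V" for z
  proof -
    have "(adj E)\<^sup>*\<^sup>* v z" using connected that edge_ends[OF vw] by (simp add: connected_graph_def)
    then show ?thesis by (induction rule: rtranclp_induct) (auto simp: adj_def only only')
  qed
  have single: "e = {v, w}" if e: "e \<in> E" for e
  proof -
    obtain p q where "e = {p, q}" "p \<noteq> q" using card_edge[OF e] by (auto simp: card_2_iff)
    then show ?thesis using V[of p] V[of q] edge_subset[OF e] by auto
  qed
  have "graph_aut V E id" by (simp add: graph_aut_def graph_iso_def)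
  moreover have "G e = id ` e" if "e \<in> E" for e
    using single[OF that] single[OF edge_map_edge[OF that]] by simp
  ultimately show ?thesis using that by blast
qed

section \<open>Image or complement\<close>

lemma image_or_complement:
  obtains s where "graph_aut V E s" "(\<forall>A \<in> TV. f A = s ` A) \<or> (\<forall>A \<in> TV. f A = V - s ` A)"
proof -
  obtain s where s: "graph_aut V E s" "\<And>e. e \<in> E \<Longrightarrow> G e = s ` e"
    using edge_map_automorphism by blast
  have bij: "bij_betw s V V" and iso: "\<And>u v. u \<in> V \<Longrightarrow> v \<in> V \<Longrightarrow> {u, v} \<in> E \<longleftrightarrow> {s u, s v} \<in> E"
    using s(1) by (auto simp: graph_aut_def graph_iso_def)
  have inj: "inj_on s V" and surj: "s ` V = V" using bij by (auto simp: bij_betw_def)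
  have im: "s ` (A \<triangle> B) = s ` A \<triangle> s ` B" if "A \<subseteq> V" "B \<subseteq> V" for A B
  proof -
    have "s ` (A - B) = s ` A - s ` B" "s ` (B - A) = s ` B - s ` A"
      using that by (auto intro!: inj_on_image_set_diff[OF inj])
    then show ?thesis by (simp add: sd_def image_Un)
  qed
  have f_move: "f (A \<triangle> e) = f A \<triangle> s ` e" if "moves A e" for A e
    using sd_lab[of f A e] edge_map_lab[OF that] s(2) that by (simp add: moves_def)
  \<comment> \<open>A move along \<open>e\<close> changes \<open>f A\<close> and the image of
    \<open>A\<close> under \<open>s\<close> by the same set, so \<open>h\<close> is
    constant.\<close>
  define h where "h A = f A \<triangle> s ` A" for A
  have const: "h A = h B" if AB: "A \<in> TV" "B \<in> TV" for A B
  proof (rule token_transport[of V "\<lambda>c d. {c, d} \<in> E" k h])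
    fix c d assume "c \<in> V" "d \<in> V"
    then have "(adj E)\<^sup>*\<^sup>* c d" using connected by (simp add: connected_graph_def)
    then show "(\<lambda>c d. c \<in> V \<and> d \<in> V \<and> {c, d} \<in> E)\<^sup>*\<^sup>* c d"
      by (rule rtranclp_mono[THEN predicate2D, rotated]) (auto simp: adj_def dest: edge_ends)
  next
    fix C c d assume C: "C \<subseteq> V" "Suc (card C) = k" "c \<in> V - C" "d \<in> V - C" "c \<noteq> d" and cd: "{c, d} \<in> E"
    have "insert c C \<in> TV" using C finite_subset[OF C(1) finite_V] by (simp add: TV_iff)
    then have m: "moves (insert c C) {c, d}" using cd C by (simp add: moves_pair)
    have *: "insert c C \<triangle> {c, d} = insert d C" using C by auto
    have "f (insert d C) = f (insert c C) \<triangle> s ` {c, d}" using f_move[OF m] * by simp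
    moreover have "s ` insert d C = s ` insert c C \<triangle> s ` {c, d}"
      using im[of "insert c C" "{c, d}"] * C by simp
    ultimately show "h (insert c C) = h (insert d C)"
      unfolding h_def by (simp only: sd_ac sd_self_left sd_self sd_empty)
  qed (use AB finite_V in \<open>auto simp: TV_iff\<close>)
  obtain A0 where A0: "A0 \<in> TV"
    by (metis TV_iff k_less diff_le_self le_trans obtain_subset_with_card_n)
  define X where "X = h A0"
  have fX: "f A = s ` A \<triangle> X" if "A \<in> TV" for A
    using const[OF that A0] unfolding X_def h_def by (metis sd_commute sd_self_right)
  have sV: "s ` A \<subseteq> V" if "A \<in> TV" for A using that surj by (auto simp: TV_iff)
  have XV: "X \<subseteq> V"
    using f_TV[OF A0] sV[OF A0] unfolding X_def h_def sd_def TV_iff by blast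
  \<comment> \<open>Exactly one of \<open>p\<close>, \<open>q\<close> lies in \<open>f A\<close>,
    and exactly one in the image of \<open>A\<close> under \<open>s\<close>; so both or neither lie
    in the difference \<open>X\<close>.\<close>
  have closed: "p \<in> X \<longleftrightarrow> q \<in> X" if pq: "{p, q} \<in> E" for p q
  proof -
    obtain c d where cd: "c \<in> V" "d \<in> V" "p = s c" "q = s d"
      using edge_ends[OF pq] surj by (metis imageE)
    then have "{c, d} \<in> E" using iso pq by simp
    then obtain A where A: "moves A {c, d}" using ex_moves by blast
    then have A': "A \<in> TV" "A \<subseteq> V" "(c \<in> A) \<noteq> (d \<in> A)" by (auto simp: moves_pair TV_iff)
    have "lab f A {c, d} = {p, q}" using edge_map_lab[OF A] s(2)[OF \<open>{c, d} \<in> E\<close>] cd by simp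
    then have "(p \<in> f A) \<noteq> (q \<in> f A)" using moves_lab[OF A] by (simp add: moves_pair)
    moreover have "p \<in> s ` A \<longleftrightarrow> c \<in> A" "q \<in> s ` A \<longleftrightarrow> d \<in> A"
      using cd A' inj by (auto simp: inj_on_image_mem_iff)
    ultimately show ?thesis using A' fX[OF A'(1)] by auto
  qed
  have "X = {} \<or> X = V"
  proof (cases "X = {}")
    case False
    then obtain p where p: "p \<in> X" by blast
    have "q \<in> X" if "q \<in> V" for q
    proof -
      have "(adj E)\<^sup>*\<^sup>* p q" using connected that p XV by (auto simp: connected_graph_def)
      then show ?thesis by (induction rule: rtranclp_induct) (use p closed in \<open>auto simp: adj_def\<close>)
    qed
    then show ?thesis using XV by blast
  qed simp
  then show ?thesis
  proof
    assume "X = {}"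
    then show ?thesis using that[OF s(1)] fX by simp
  next
    assume "X = V"
    have "f A = V - s ` A" if "A \<in> TV" for A
      using fX[OF that] sV[OF that] \<open>X = V\<close> unfolding sd_def by blast
    then show ?thesis using that[OF s(1)] by blast
  qed
qed

end

section \<open>From two reconstructions to a token automorphism\<close>

lemma token_edges_iff:
  assumes "A \<in> token_vertices V k" "B \<in> token_vertices V k"
  shows "{A, B} \<in> token_edges V E k \<longleftrightarrow> A \<triangle> B \<in> E"
proof
  assume "{A, B} \<in> token_edges V E k"
  then obtain C D where "{A, B} = {C, D}" "C \<triangle> D \<in> E" by (auto simp: token_edges_def sd_def)
  then show "A \<triangle> B \<in> E" by (auto simp: doubleton_eq_iff sd_commute)
next
  assume "A \<triangle> B \<in> E"
  then show "{A, B} \<in> token_edges V E k" using assms by (auto simp: token_edges_def sd_def)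
qed

theorem theorem4:
  fixes V :: "'a set" and E :: "'a set set" and k :: nat
  assumes "simple_graph V E"
    and "connected_graph V E"
    and "C4_free V E"
    and "diamond_free V E"
    and "1 \<le> k" and "k \<le> card V - 1"
  shows "uniquely_reconstructible (token_vertices V k) (token_edges V E k) V E k"
  unfolding uniquely_reconstructible_def
proof (intro allI impI)
  let ?TV = "token_vertices V k" and ?TE = "token_edges V E k"
  fix \<phi> \<psi> :: "'a set \<Rightarrow> 'a set"
  assume "token_reconstruction ?TV ?TE V E k \<phi> \<and> token_reconstruction ?TV ?TE V E k \<psi>"
  then have bij: "bij_betw \<phi> ?TV ?TV" "bij_betw \<psi> ?TV ?TV"
    and iso: "\<And>A B. A \<in> ?TV \<Longrightarrow> B \<in> ?TV \<Longrightarrow> {A, B} \<in> ?TE \<longleftrightarrow> {\<phi> A, \<phi> B} \<in> ?TE"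
      "\<And>A B. A \<in> ?TV \<Longrightarrow> B \<in> ?TV \<Longrightarrow> {A, B} \<in> ?TE \<longleftrightarrow> {\<psi> A, \<psi> B} \<in> ?TE"
    by (auto simp: token_reconstruction_def graph_iso_def)
  define \<phi>' where "\<phi>' = inv_into ?TV \<phi>"
  define \<psi>' where "\<psi>' = inv_into ?TV \<psi>"
  have im: "\<phi> A \<in> ?TV" "\<psi> A \<in> ?TV" "\<phi>' A \<in> ?TV" "\<psi>' A \<in> ?TV" if "A \<in> ?TV" for A
    using that bij bij_betw_inv_into unfolding \<phi>'_def \<psi>'_def by (metis bij_betwE)+
  have inverse: "\<phi> (\<phi>' A) = A" "\<phi>' (\<phi> A) = A" "\<psi> (\<psi>' A) = A" "\<psi>' (\<psi> A) = A" if "A \<in> ?TV" for A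
    using that bij unfolding \<phi>'_def \<psi>'_def
    by (simp_all add: bij_betw_inv_into_left bij_betw_inv_into_right)
  \<comment> \<open>The inverse of \<open>\<phi>\<close> followed by \<open>\<psi>\<close> is an
    automorphism of the token graph; evaluated at \<open>\<phi> A\<close> it returns
    \<open>\<psi> A\<close>.\<close>
  interpret token_aut V E k "\<psi> \<circ> \<phi>'" "\<phi> \<circ> \<psi>'"
  proof
    fix A B assume AB: "A \<in> ?TV" "B \<in> ?TV"
    have "{\<psi> (\<phi>' A), \<psi> (\<phi>' B)} \<in> ?TE \<longleftrightarrow> {\<phi>' A, \<phi>' B} \<in> ?TE"
      using iso(2) im AB by blast
    also have "\<dots> \<longleftrightarrow> {A, B} \<in> ?TE"
      using iso(1)[of "\<phi>' A" "\<phi>' B"] im inverse AB by simp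
    finally show "(\<psi> \<circ> \<phi>') A \<triangle> (\<psi> \<circ> \<phi>') B \<in> E \<longleftrightarrow> A \<triangle> B \<in> E"
      using im AB by (simp add: token_edges_iff)
  qed (use assms im inverse in auto)
  obtain s where s: "graph_aut V E s"
    "(\<forall>A \<in> ?TV. (\<psi> \<circ> \<phi>') A = s ` A) \<or> (\<forall>A \<in> ?TV. (\<psi> \<circ> \<phi>') A = V - s ` A)"
    by (rule image_or_complement)
  have "(\<psi> \<circ> \<phi>') (\<phi> A) = \<psi> A" if "A \<in> ?TV" for A using inverse that by simp
  then show "equivalent_reconstructions ?TV V E \<phi> \<psi>"
    unfolding equivalent_reconstructions_def using s im(1) by metis
qed

end
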